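(* Let $\mathcal{A}:\mathbb{S}^n\to\mathbb{R}^m$ be a surjective linear map and $b\in\mathbb{R}^m$, and suppose that $\mathcal{F}=\{X\in\mathbb{S}^n_+ : \mathcal{A}(X)=b\}$ is non-empty, bounded and contained in a proper face of $\mathbb{S}^n_+$. Suppose moreover that the minimal face of $\mathbb{S}^n_+$ containing $\mathcal{F}$ is $$\operatorname{face}(\mathcal{F})=\begin{bmatrix}\mathbb{S}^r_+ & 0 \\ 0 & 0\end{bmatrix}.$$ Let $A_1,\dots,A_q$, $q=\frac{n(n+1)}2-m$, be a basis of $\operatorname{null}(\mathcal{A})$, and partition $$A_i=\begin{bmatrix} L_i & M_i \\ M_i^T & N_i \end{bmatrix},\qquad L_i\in\mathbb{S}^r,\ N_i\in\mathbb{S}^{n-r},\quad i=1,\dots,q.$$ If $\operatorname{span}\{N_1,\dots,N_q\}\cap\mathbb{S}^{n-r}_+=\{0\}$ and $\bar X=\lim_{\alpha\searrow0}X(\alpha)$ is the limit point of the primal part of the parametric path, then $\bar X=\hat X$, where $\hat X$ is the analytic center of $\mathcal{F}$.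
   Context: $\mathbb{S}^n$ is the space of real symmetric $n\times n$ matrices with inner product $\langle X,Y\rangle=\operatorname{trace}(XY)$; $\mathbb{S}^n_+$ is the cone of positive semidefinite matrices. A closed convex cone $f\subseteq\mathbb{S}^n_+$ is a face of $\mathbb{S}^n_+$ if $X,Y\in\mathbb{S}^n_+$ and $X+Y\in f$ imply $X,Y\in f$; it is proper if $f\neq\mathbb{S}^n_+$ and $f\neq 0$. $\operatorname{face}(\mathcal{F})$ is the smallest face of $\mathbb{S}^n_+$ containing $\mathcal{F}$. Here $r$ is the maximal rank of an element of $\mathcal{F}$. For $\alpha>0$, $X(\alpha)$ denotes the unique maximizer of $\log\det(X)$ over $\mathcal{F}(\alpha):=\{X\in\mathbb{S}^n_+ : \mathcal{A}(X)=b+\alpha\mathcal{A}(I)\}$ (with $\log\det X=-\infty$ for singular $X$). Under the stated assumptions on $\mathcal{A}$ and $\mathcal{F}$, $\lim_{\alpha\searrow0}X(\alpha)$ exists. Analytic center: let the columns of $V\in\mathbb{R}^{n\times r}$ form a basis of the range of a matrix in $\operatorname{relint}(\mathcal{F})$. The analytic center $\hat X$ of $\mathcal{F}$ is the unique maximizer of $\log\det(V^TXV)$ over $X\in\mathcal{F}$. In the present coordinates one may take $V=\begin{bmatrix} I_r \\ 0 \end{bmatrix}$, so $\hat X$ maximizes the determinant of the leading $r\times r$ block. *)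

theory Defs
  imports "HOL-Analysis.Analysis"
begin

text \<open>
  Symmetric matrices form a subspace of \<^typ>\<open>real^'n^'n\<close>, whose library inner product (the
  entrywise one) restricts to \<open>trace (X ** Y)\<close> on it.

  A block decomposition of the index set is given by a set \<open>J\<close> of indices (the leading ones) and
  its complement; \<open>r = card J\<close> may then be any number between \<open>0\<close> and \<open>CARD('n)\<close>.  The
  square matrices of order \<open>card J\<close> are embedded in \<^typ>\<open>real^'n^'n\<close> by zero padding.
\<close>

definition sym_mats :: "(real^'n^'n) set" where
  "sym_mats = {X. transpose X = X}"

definition psd :: "(real^'n^'n) set" where
  "psd = {X \<in> sym_mats. \<forall>v. 0 \<le> v \<bullet> (X *v v)}"

definition psd_on :: "'n set \<Rightarrow> (real^'n^'n) set" where
  "psd_on J = {X \<in> psd. \<forall>i j. i \<notin> J \<or> j \<notin> J \<longrightarrow> X $ i $ j = 0}"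

definition block :: "'n set \<Rightarrow> real^'n^'n \<Rightarrow> real^'n^'n" where
  "block J X = (\<chi> i j. if i \<in> J \<and> j \<in> J then X $ i $ j else 0)"

definition psd_face :: "(real^'n^'n) set \<Rightarrow> bool" where
  "psd_face f \<longleftrightarrow> f \<subseteq> psd \<and> closed f \<and> convex_cone f \<and>
     (\<forall>X\<in>psd. \<forall>Y\<in>psd. X + Y \<in> f \<longrightarrow> X \<in> f \<and> Y \<in> f)"

definition proper_psd_face :: "(real^'n^'n) set \<Rightarrow> bool" where
  "proper_psd_face f \<longleftrightarrow> psd_face f \<and> f \<noteq> psd \<and> f \<noteq> {0}"

text \<open>Faces are closed under intersection, so this is the smallest face containing \<open>F\<close>.\<close>

definition min_face :: "(real^'n^'n) set \<Rightarrow> (real^'n^'n) set" where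
  "min_face F = \<Inter> {f. psd_face f \<and> F \<subseteq> f}"

definition spectrahedron :: "(real^'n^'n \<Rightarrow> real^'m) \<Rightarrow> real^'m \<Rightarrow> (real^'n^'n) set" where
  "spectrahedron \<A> b = {X \<in> psd. \<A> X = b}"

definition null_space :: "(real^'n^'n \<Rightarrow> real^'m) \<Rightarrow> (real^'n^'n) set" where
  "null_space \<A> = {X \<in> sym_mats. \<A> X = 0}"

definition eln :: "real \<Rightarrow> ereal" where
  "eln x = (if 0 < x then ereal (ln x) else -\<infinity>)"

definition path_point :: "(real^'n^'n \<Rightarrow> real^'m) \<Rightarrow> real^'m \<Rightarrow> real \<Rightarrow> real^'n^'n" where
  "path_point \<A> b \<alpha> =
     (THE X. is_arg_max (\<lambda>X. eln (det X))
               (\<lambda>X. X \<in> spectrahedron \<A> (b + \<alpha> *\<^sub>R \<A> (mat 1))) X)"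

text \<open>
  An \<open>n \<times> r\<close> matrix \<open>V\<close> is represented by its columns \<open>V 0, \<dots>, V (r - 1)\<close>.  The entries of
  \<open>V\<^sup>T X V\<close> are \<open>V i \<bullet> (X *v V j)\<close>; its determinant is given by the Leibniz formula over
  \<open>{..<r}\<close>, because \<open>r\<close> is a number (possibly \<open>0\<close>) and not the cardinality of a type.
\<close>

definition det_upto :: "nat \<Rightarrow> (nat \<Rightarrow> nat \<Rightarrow> real) \<Rightarrow> real" where
  "det_upto r K = (\<Sum>p | p permutes {..<r}. of_int (sign p) * (\<Prod>i<r. K i (p i)))"

definition range_basis :: "nat \<Rightarrow> (nat \<Rightarrow> real^'n) \<Rightarrow> real^'n^'n \<Rightarrow> bool" where
  "range_basis r V R \<longleftrightarrow> inj_on V {..<r} \<and> independent (V ` {..<r}) \<and>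
     span (V ` {..<r}) = range (\<lambda>x. R *v x)"

definition analytic_center ::
    "nat \<Rightarrow> (nat \<Rightarrow> real^'n) \<Rightarrow> (real^'n^'n) set \<Rightarrow> real^'n^'n" where
  "analytic_center r V F =
     (THE X. is_arg_max (\<lambda>X. eln (det_upto r (\<lambda>i j. V i \<bullet> (X *v V j)))) (\<lambda>X. X \<in> F) X)"

end

theory Submission
  imports Defs
begin

text \<open>
  No derivatives are used.  Let \<open>K\<close> be the set of positive semidefinite trailing blocks \<open>S\<close> with
  \<open>S - I\<close> in the span of the \<open>N\<^sub>i\<close>; it is compact because that span meets the cone only in \<open>0\<close>.
  The trailing block of every feasible point for the parameter \<open>\<alpha>\<close> lies in \<open>\<alpha> K\<close>, so by Fischer's
  inequality \<open>det X(\<alpha>)\<close> is at most \<open>\<alpha>\<close> to the power \<open>n - r\<close> times \<open>det P(\<alpha>) * det S(\<alpha>)\<close>, where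
  \<open>P(\<alpha>)\<close> is the leading block and \<open>S(\<alpha>) \<in> K\<close>.  Conversely, combining the analytic center with the
  determinant maximizer of \<open>K\<close> gives feasible points whose determinant attains, up to a factor
  tending to \<open>1\<close>, the same power of \<open>\<alpha>\<close> times the maximum of \<open>det P * det S\<close> over the product
  of \<open>\<F>\<close> and \<open>K\<close>.  Hence every limit point of \<open>(P(\<alpha>), S(\<alpha>))\<close> is the maximizer of this product,
  which is unique by strict log-concavity of the determinant.
\<close>

subsection \<open>Simultaneous diagonalization\<close>

definition pos_def :: "(real^'n^'n) set" where
  "pos_def = {X \<in> sym_mats. \<forall>v. v \<noteq> 0 \<longrightarrow> 0 < v \<bullet> (X *v v)}"

lemma sym_mats_iff: "X \<in> sym_mats \<longleftrightarrow> (\<forall>i j. X $ i $ j = X $ j $ i)"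
  by (auto simp: sym_mats_def transpose_def vec_eq_iff)

lemma sym_mats_dot: "X \<in> sym_mats \<Longrightarrow> x \<bullet> (X *v y) = y \<bullet> (X *v x)"
  by (metis (mono_tags) dot_lmul_matrix inner_commute mem_Collect_eq sym_mats_def vector_transpose_matrix)

lemma subspace_sym_mats: "subspace sym_mats"
  by (auto simp: subspace_def sym_mats_iff)

lemma continuous_on_quadratic_form: "continuous_on S (\<lambda>x. x \<bullet> ((X::real^'n^'n) *v x))"
  by (intro continuous_intros linear_continuous_on matrix_vector_mul_bounded_linear)

lemma pos_def_imp_sym: "X \<in> pos_def \<Longrightarrow> X \<in> sym_mats"
  by (simp add: pos_def_def)

lemma pos_def_imp_psd: "X \<in> pos_def \<Longrightarrow> X \<in> psd"
  unfolding pos_def_def psd_def by auto (metis inner_zero_left less_imp_le order_refl)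

lemma pos_def_add_psd: "X \<in> pos_def \<Longrightarrow> Y \<in> psd \<Longrightarrow> X + Y \<in> pos_def"
  unfolding pos_def_def psd_def
  by (auto simp: matrix_vector_mult_add_rdistrib inner_add_right subspace_add[OF subspace_sym_mats]
      add_pos_nonneg)

lemma pos_def_scaleR: "X \<in> pos_def \<Longrightarrow> 0 < c \<Longrightarrow> c *\<^sub>R X \<in> pos_def"
  unfolding pos_def_def
  by (auto simp: subspace_scale[OF subspace_sym_mats] simp flip: scaleR_matrix_vector_assoc)

lemma mat_1_pos_def: "mat 1 \<in> pos_def"
  by (auto simp: pos_def_def sym_mats_def)

text \<open>By homogeneity it suffices to bound the form on the unit sphere, where compactness gives
  a minimizer; its value is the constant.\<close>

lemma pos_def_coercive:
  assumes "(X::real^'n^'n) \<in> pos_def"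
  obtains c where "0 < c" "\<And>v. c * (norm v)\<^sup>2 \<le> v \<bullet> (X *v v)"
proof -
  let ?S = "sphere 0 1 :: (real^'n) set"
  have ne: "?S \<noteq> {}" by simp
  obtain u where u: "u \<in> ?S" "\<And>v. v \<in> ?S \<Longrightarrow> u \<bullet> (X *v u) \<le> v \<bullet> (X *v v)"
    using continuous_attains_inf[OF compact_sphere ne continuous_on_quadratic_form] by blast
  have "u \<noteq> 0" using u(1) by auto
  then have "0 < u \<bullet> (X *v u)" using assms by (auto simp: pos_def_def)
  moreover have "(u \<bullet> (X *v u)) * (norm v)\<^sup>2 \<le> v \<bullet> (X *v v)" for v
  proof (cases "v = 0")
    case False
    then have "(1 / norm v) *\<^sub>R v \<in> ?S" by simp
    from u(2)[OF this] show ?thesis using False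
      by (simp add: matrix_vector_mult_scaleR field_simps power2_eq_square)
  qed simp
  ultimately show thesis using that by blast
qed

text \<open>Stands in for differentiation: it is the first-order condition at the minimum
  \<open>t = 0\<close> of a quadratic polynomial.\<close>

lemma linear_coeff_zero:
  fixes a b :: real
  assumes "\<And>t. 0 \<le> 2 * t * a + t\<^sup>2 * b"
  shows "a = 0"
proof (rule ccontr)
  assume "a \<noteq> 0"
  \<comment> \<open>With this \<open>c\<close>, the linear term outweighs the quadratic one at
    \<open>t = - a / c\<close>.\<close>
  define c where "c = 1 + \<bar>b\<bar>"
  have c: "0 < c" "b - 2 * c < 0" by (auto simp: c_def)
  have "0 \<le> (2 * (- a / c) * a + (- a / c)\<^sup>2 * b) * c\<^sup>2"
    using assms[of "- a / c"] by simp
  also have "\<dots> = a\<^sup>2 * (b - 2 * c)"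
    using c by (simp add: field_simps power2_eq_square)
  finally show False
    using c(2) \<open>a \<noteq> 0\<close> by (simp add: zero_le_mult_iff)
qed

lemma quadratic_form_add:
  assumes "X \<in> sym_mats"
  shows "(u + t *\<^sub>R y) \<bullet> (X *v (u + t *\<^sub>R y))
    = u \<bullet> (X *v u) + 2 * t * (y \<bullet> (X *v u)) + t\<^sup>2 * (y \<bullet> (X *v y))"
  by (simp add: matrix_vector_right_distrib matrix_vector_mult_scaleR inner_add_left inner_add_right
      sym_mats_dot[OF assms, of u y] power2_eq_square algebra_simps)

text \<open>Such a \<open>v\<close> minimizes the form. Perturbing it in the direction
  \<open>X *v v\<close> makes the squared norm of \<open>X *v v\<close> the linear coefficient,
  which must vanish.\<close>

lemma psd_kernel:
  assumes "X \<in> psd" "v \<bullet> (X *v v) = 0"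
  shows "X *v v = 0"
proof -
  have X: "X \<in> sym_mats" "\<And>w. 0 \<le> w \<bullet> (X *v w)" using assms(1) by (auto simp: psd_def)
  let ?w = "X *v v"
  have "?w \<bullet> ?w = 0"
    by (rule linear_coeff_zero[of _ "?w \<bullet> (X *v ?w)"])
      (use X(2)[of "v + _ *\<^sub>R ?w"] assms(2) in \<open>simp add: quadratic_form_add[OF X(1)]\<close>)
  then show ?thesis by simp
qed

lemma congruence_component:
  fixes W M :: "real^'n^'n"
  shows "(transpose W ** M ** W) $ i $ j = column i W \<bullet> (M *v column j W)"
  unfolding matrix_matrix_mult_def transpose_def column_def inner_vec_def matrix_vector_mult_def
  by (simp add: sum_distrib_left sum_distrib_right mult.assoc) (rule sum.swap)

text \<open>One step of the spectral theorem for the inner product with Gram matrix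
  \<open>C\<close>: the new eigenvector maximizes the Rayleigh quotient of \<open>X\<close> on the
  \<open>C\<close>-orthogonal complement of those already found.\<close>

lemma generalized_eigenvector_orthogonal:
  fixes C X :: "real^'n^'n" and B :: "'n set"
  assumes C: "C \<in> pos_def" and X: "X \<in> sym_mats" and B: "B \<noteq> UNIV"
    and eig: "\<And>i. i \<in> B \<Longrightarrow> X *v w i = l i *\<^sub>R (C *v w i)"
    and orth: "\<And>i j. i \<in> B \<Longrightarrow> j \<in> B \<Longrightarrow> w i \<bullet> (C *v w j) = (if i = j then 1 else 0)"
  obtains u m where "X *v u = m *\<^sub>R (C *v u)" "u \<bullet> (C *v u) = 1" "\<And>i. i \<in> B \<Longrightarrow> u \<bullet> (C *v w i) = 0"
proof -
  have Cs: "C \<in> sym_mats" and Cp: "\<And>v. v \<noteq> 0 \<Longrightarrow> 0 < v \<bullet> (C *v v)"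
    using C by (auto simp: pos_def_def)
  define T where "T = {x. \<forall>i\<in>B. x \<bullet> (C *v w i) = 0}"
  have T_add: "x + t *\<^sub>R y \<in> T" if "x \<in> T" "y \<in> T" for x y t
    using that by (auto simp: T_def inner_add_left)
  have T_scale: "t *\<^sub>R x \<in> T" if "x \<in> T" for x t
    using that by (auto simp: T_def)
  have closed_T: "closed T"
    unfolding T_def Collect_ball_eq by (intro closed_INT ballI closed_Collect_eq continuous_intros)
  \<comment> \<open>As \<open>B\<close> misses an index, the vectors \<open>C *v w i\<close> do not
    span the space, so \<open>T\<close> contains a nonzero vector.\<close>
  have "dim ((\<lambda>i. C *v w i) ` B) \<le> card B"
    by (rule order_trans[OF dim_le_card']) (auto intro: card_image_le)
  also have "\<dots> < CARD('n)" using B by (intro psubset_card_mono) auto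
  finally have "dim ((\<lambda>i. C *v w i) ` B) < DIM(real^'n)" by simp
  then obtain x where x: "x \<noteq> 0" "\<And>y. y \<in> span ((\<lambda>i. C *v w i) ` B) \<Longrightarrow> orthogonal x y"
    using orthogonal_to_subspace_exists by blast
  then have xT: "x \<in> T" by (auto simp: T_def orthogonal_def span_base)
  \<comment> \<open>The unit sphere of \<open>T\<close> in the \<open>C\<close>-norm; coercivity of
    \<open>C\<close> makes it bounded.\<close>
  define K where "K = T \<inter> {x. x \<bullet> (C *v x) = 1}"
  have normalize: "(1 / sqrt (y \<bullet> (C *v y))) *\<^sub>R y \<in> K" if "y \<in> T" "y \<noteq> 0" for y
    using T_scale[OF that(1)] Cp[OF that(2)] by (simp add: K_def matrix_vector_mult_scaleR)
  have Kne: "K \<noteq> {}" using normalize[OF xT x(1)] by blast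
  obtain c where c: "0 < c" "\<And>v. c * (norm v)\<^sup>2 \<le> v \<bullet> (C *v v)"
    using pos_def_coercive[OF C] by blast
  have "norm v \<le> sqrt (1 / c)" if "v \<in> K" for v
  proof -
    have "(norm v)\<^sup>2 \<le> 1 / c" using c(2)[of v] c(1) that by (simp add: K_def field_simps)
    then show ?thesis by (rule real_le_rsqrt)
  qed
  then have "bounded K" by (auto simp: bounded_iff)
  moreover have "closed K" unfolding K_def
    by (intro closed_Int closed_T closed_Collect_eq continuous_on_quadratic_form continuous_intros)
  ultimately have "compact K" by (simp add: compact_eq_bounded_closed)
  from continuous_attains_sup[OF this Kne continuous_on_quadratic_form[of _ X]]
  obtain u where u: "u \<in> K" and max: "\<And>v. v \<in> K \<Longrightarrow> v \<bullet> (X *v v) \<le> u \<bullet> (X *v u)" by blast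
  define m where "m = u \<bullet> (X *v u)"
  have uT: "u \<in> T" and u1: "u \<bullet> (C *v u) = 1" using u by (auto simp: K_def)
  have rayleigh: "y \<bullet> (X *v y) \<le> m * (y \<bullet> (C *v y))" if "y \<in> T" for y
  proof (cases "y = 0")
    case False
    from max[OF normalize[OF that False]] Cp[OF False] show ?thesis
      by (simp add: matrix_vector_mult_scaleR m_def field_simps)
  qed simp
  \<comment> \<open>By \<open>rayleigh\<close> the difference of the two sides is nonnegative on
    \<open>T\<close> and vanishes at \<open>u\<close>, so its linear term in every direction of
    \<open>T\<close> is zero.\<close>
  have on_T: "y \<bullet> (m *\<^sub>R (C *v u) - X *v u) = 0" if "y \<in> T" for y
  proof (rule linear_coeff_zero)
    fix t
    have "0 \<le> m * ((u + t *\<^sub>R y) \<bullet> (C *v (u + t *\<^sub>R y))) - (u + t *\<^sub>R y) \<bullet> (X *v (u + t *\<^sub>R y))"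
      using rayleigh[OF T_add[OF uT that]] by simp
    also have "\<dots> = 2 * t * (y \<bullet> (m *\<^sub>R (C *v u) - X *v u))
        + t\<^sup>2 * (m * (y \<bullet> (C *v y)) - y \<bullet> (X *v y))"
      unfolding quadratic_form_add[OF X] quadratic_form_add[OF Cs] u1
      by (simp add: m_def[symmetric] inner_diff_right algebra_simps)
    finally show "0 \<le> 2 * t * (y \<bullet> (m *\<^sub>R (C *v u) - X *v u))
        + t\<^sup>2 * (m * (y \<bullet> (C *v y)) - y \<bullet> (X *v y))" .
  qed
  have on_w: "w i \<bullet> (m *\<^sub>R (C *v u) - X *v u) = 0" if "i \<in> B" for i
  proof -
    have "u \<bullet> (C *v w i) = 0" using uT that by (simp add: T_def)
    then show ?thesis
      by (simp add: inner_diff_right sym_mats_dot[OF Cs, of "w i"] sym_mats_dot[OF X, of "w i"]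
          eig[OF that])
  qed
  have "x \<bullet> (m *\<^sub>R (C *v u) - X *v u) = 0" for x
  proof -
    \<comment> \<open>\<open>?p\<close> is the \<open>C\<close>-orthogonal projection of
      \<open>x\<close> onto the span of the \<open>w i\<close>. The residual is orthogonal to both
      \<open>x - ?p\<close> and \<open>?p\<close>, hence to every vector, itself included.\<close>
    let ?p = "\<Sum>i\<in>B. (x \<bullet> (C *v w i)) *\<^sub>R w i"
    have "?p \<bullet> (C *v w j) = x \<bullet> (C *v w j)" if "j \<in> B" for j
    proof -
      have "?p \<bullet> (C *v w j) = (\<Sum>i\<in>B. if i = j then x \<bullet> (C *v w i) else 0)"
        unfolding inner_sum_left using that by (intro sum.cong) (auto simp: orth)
      then show ?thesis using that by simp
    qed
    then have "x - ?p \<in> T" by (auto simp: T_def inner_diff_left)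
    from on_T[OF this] have "x \<bullet> (m *\<^sub>R (C *v u) - X *v u) = ?p \<bullet> (m *\<^sub>R (C *v u) - X *v u)"
      by (simp add: inner_diff_left)
    also have "\<dots> = 0" by (simp add: inner_sum_left on_w)
    finally show ?thesis .
  qed
  from this[of "m *\<^sub>R (C *v u) - X *v u"] have "X *v u = m *\<^sub>R (C *v u)" by simp
  with u1 uT show thesis using that by (auto simp: T_def)
qed

text \<open>Eigenvectors are collected one index at a time, by induction over subsets
  \<open>B\<close> of the index set; they become the columns of \<open>W\<close>.\<close>

lemma simultaneous_diagonalization:
  fixes C X :: "real^'n^'n"
  assumes C: "C \<in> pos_def" and X: "X \<in> sym_mats"
  obtains W :: "real^'n^'n" and l :: "'n \<Rightarrow> real"
  where "transpose W ** C ** W = mat 1" "transpose W ** X ** W = (\<chi> i j. if i = j then l i else 0)"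
proof -
  have "\<exists>w l. (\<forall>i\<in>B. X *v w i = l i *\<^sub>R (C *v w i)) \<and>
      (\<forall>i\<in>B. \<forall>j\<in>B. w i \<bullet> (C *v w j) = (if i = j then 1 else 0))" for B :: "'n set"
    using finite[of B]
  proof (induction B rule: finite_induct)
    case (insert k B)
    then obtain w l where w: "\<And>i. i \<in> B \<Longrightarrow> X *v w i = l i *\<^sub>R (C *v w i)"
      "\<And>i j. i \<in> B \<Longrightarrow> j \<in> B \<Longrightarrow> w i \<bullet> (C *v w j) = (if i = j then 1 else 0)" by metis
    from insert(2) have "B \<noteq> UNIV" by auto
    from generalized_eigenvector_orthogonal[OF C X this w] obtain u m where
      u: "X *v u = m *\<^sub>R (C *v u)" "u \<bullet> (C *v u) = 1" "\<And>i. i \<in> B \<Longrightarrow> u \<bullet> (C *v w i) = 0" by blast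
    have "w i \<bullet> (C *v u) = 0" if "i \<in> B" for i
      using u(3)[OF that] C sym_mats_dot[of C] by (auto simp: pos_def_def)
    with u w insert(2) show ?case
      by (intro exI[of _ "w(k := u)"] exI[of _ "l(k := m)"]) auto
  qed simp
  from this[of UNIV] obtain w :: "'n \<Rightarrow> real^'n" and l where
    w: "\<And>i. X *v w i = l i *\<^sub>R (C *v w i)"
      "\<And>i j. w i \<bullet> (C *v w j) = (if i = j then 1 else 0)"
    by (metis UNIV_I)
  define W where "W = (\<chi> i j. w j $ i)"
  have "column i W = w i" for i
    by (simp add: W_def column_def)
  then have WMW: "transpose W ** M ** W = (\<chi> i j. w i \<bullet> (M *v w j))" for M
    by (intro vec_eq_iff[THEN iffD2] allI) (simp add: congruence_component)
  show thesis
  proof (rule that[of W l])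
    show "transpose W ** C ** W = mat 1" by (simp add: WMW w(2) mat_def)
    show "transpose W ** X ** W = (\<chi> i j. if i = j then l i else 0)"
      by (simp add: WMW w vec_eq_iff)
  qed
qed

subsection \<open>Log-concavity of the determinant\<close>

lemma pos_def_congruence:
  fixes X W :: "real^'n^'n"
  assumes "X \<in> pos_def" "det W \<noteq> 0"
  shows "transpose W ** X ** W \<in> pos_def"
proof -
  have "transpose (transpose W ** X ** W) = transpose W ** X ** W"
    using assms(1) by (simp add: pos_def_def sym_mats_def matrix_transpose_mul matrix_mul_assoc)
  moreover have "0 < v \<bullet> ((transpose W ** X ** W) *v v)" if "v \<noteq> 0" for v
  proof -
    have "W *v v \<noteq> 0"
      using assms(2) that by (metis invertible_det_nz invertible_left_inverse matrix_left_invertible_ker)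
    then have "0 < (W *v v) \<bullet> (X *v (W *v v))" using assms(1) by (auto simp: pos_def_def)
    also have "\<dots> = v \<bullet> ((transpose W ** X ** W) *v v)"
      by (metis dot_lmul_matrix matrix_vector_mul_assoc vector_transpose_matrix transpose_transpose)
    finally show ?thesis .
  qed
  ultimately show ?thesis by (auto simp: pos_def_def sym_mats_def)
qed

lemma pos_def_diagonal_pos: "X \<in> pos_def \<Longrightarrow> 0 < X $ i $ i"
  by (auto simp: pos_def_def matrix_vector_mul_component inner_axis' inner_axis dest!: spec[of _ "axis i 1"])

text \<open>Diagonalizing \<open>X\<close> against itself shows it congruent to the identity, so
  \<open>det X\<close> times a square is \<open>1\<close>.\<close>

lemma pos_def_det_pos:
  fixes X :: "real^'n^'n"
  assumes "X \<in> pos_def"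
  shows "0 < det X"
proof -
  obtain W :: "real^'n^'n" and l where "transpose W ** X ** W = mat 1"
      "transpose W ** X ** W = (\<chi> i j. if i = j then l i else 0)"
    by (rule simultaneous_diagonalization[OF assms pos_def_imp_sym[OF assms]]) blast
  then have "det W * det X * det W = 1" by (metis det_I det_mul det_transpose)
  then have "det X * (det W)\<^sup>2 = 1" by (simp add: power2_eq_square algebra_simps)
  then have "0 < det X * (det W)\<^sup>2" by simp
  then show ?thesis by (simp add: zero_less_mult_iff)
qed

lemma psd_det_nonzero_imp_pos_def:
  assumes "X \<in> psd" "det X \<noteq> 0"
  shows "X \<in> pos_def"
proof -
  have "0 < v \<bullet> (X *v v)" if "v \<noteq> 0" for v
  proof -
    have "X *v v \<noteq> 0"
      using assms(2) that by (metis invertible_det_nz invertible_left_inverse matrix_left_invertible_ker)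
    then have "v \<bullet> (X *v v) \<noteq> 0" using psd_kernel[OF assms(1)] by blast
    then show ?thesis using assms(1) by (auto simp: psd_def less_le)
  qed
  then show ?thesis using assms(1) by (auto simp: pos_def_def psd_def)
qed

text \<open>Simultaneous diagonalization to \<open>mat 1\<close> and \<open>diag l\<close> reduces the inequality to
  \<open>l i \<le> ((1 + l i) / 2)\<^sup>2\<close>, which is strict unless \<open>l i = 1\<close>.\<close>

lemma det_midpoint_strict:
  fixes X Y :: "real^'n^'n"
  assumes X: "X \<in> pos_def" and Y: "Y \<in> pos_def" and "X \<noteq> Y"
  shows "det X * det Y < (det ((1/2) *\<^sub>R (X + Y)))\<^sup>2"
proof -
  obtain W :: "real^'n^'n" and l where W: "transpose W ** X ** W = mat 1"
    "transpose W ** Y ** W = (\<chi> i j. if i = j then l i else 0)"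
    by (rule simultaneous_diagonalization[OF X pos_def_imp_sym[OF Y]]) blast
  have dX: "det X * (det W)\<^sup>2 = 1"
    using arg_cong[OF W(1), of det] by (simp add: det_mul power2_eq_square algebra_simps)
  then have d: "det W \<noteq> 0" by auto
  have dY: "det Y * (det W)\<^sup>2 = prod l UNIV"
    using arg_cong[OF W(2), of det] by (simp add: det_mul power2_eq_square algebra_simps det_diagonal)
  have "transpose W ** ((1/2) *\<^sub>R (X + Y)) ** W
      = (1/2) *\<^sub>R (transpose W ** X ** W + transpose W ** Y ** W)"
    by (simp add: vec_eq_iff matrix_matrix_mult_def sum_distrib_left sum_distrib_right sum.distrib
        algebra_simps)
  also have "\<dots> = (\<chi> i j. if i = j then (1 + l i) / 2 else 0)"
    by (simp add: W vec_eq_iff mat_def)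
  finally have "det (transpose W ** ((1/2) *\<^sub>R (X + Y)) ** W)
      = det (\<chi> i j. if i = j then (1 + l i) / 2 else 0)" by (rule arg_cong)
  then have dm: "det ((1/2) *\<^sub>R (X + Y)) * (det W)\<^sup>2 = (\<Prod>i\<in>UNIV. (1 + l i) / 2)"
    unfolding det_mul by (simp add: power2_eq_square mult_ac det_diagonal)
  have l_pos: "0 < l i" for i
    using pos_def_diagonal_pos[OF pos_def_congruence[OF Y d], of i] by (simp add: W(2))
  obtain k where k: "l k \<noteq> 1"
  \<comment> \<open>If all \<open>l i\<close> were \<open>1\<close>, the transforms of
    \<open>X\<close> and \<open>Y\<close> would coincide, and cancelling the invertible
    \<open>W\<close> would give \<open>X = Y\<close>.\<close>
  proof (rule ccontr)
    assume "\<not> thesis"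
    then have "\<And>i. l i = 1" using that by blast
    then have *: "transpose W ** Y ** W = transpose W ** X ** W" by (simp add: W mat_def vec_eq_iff)
    obtain Wi where Wi: "W ** Wi = mat 1" using d invertible_det_nz invertible_def by blast
    then have "transpose Wi ** transpose W = mat 1" by (metis matrix_transpose_mul transpose_mat)
    with Wi have "transpose Wi ** (transpose W ** Z ** W) ** Wi = Z" for Z :: "real^'n^'n"
      by (metis matrix_mul_assoc matrix_mul_lid matrix_mul_rid)
    with * \<open>X \<noteq> Y\<close> show False by metis
  qed
  have amgm: "l i \<le> ((1 + l i) / 2)\<^sup>2" for i
    using sum_squares_ge_zero[of "1 - l i" 0] by (simp add: power2_eq_square field_simps)
  have amgm_k: "l k < ((1 + l k) / 2)\<^sup>2"
    using not_sum_squares_lt_zero[of "1 - l k" 0] k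
      sum_squares_gt_zero_iff[of "1 - l k" 0] by (simp add: power2_eq_square field_simps)
  \<comment> \<open>After multiplication by the fourth power of \<open>det W\<close> both sides are
    products over the \<open>l i\<close>; the factor at \<open>k\<close> makes the comparison
    strict.\<close>
  have "det X * det Y * ((det W)\<^sup>2)\<^sup>2 = (det X * (det W)\<^sup>2) * (det Y * (det W)\<^sup>2)"
    by (simp only: power2_eq_square mult_ac)
  also have "\<dots> = prod l UNIV" by (simp add: dX dY)
  also have "\<dots> = l k * prod l (UNIV - {k})" by (simp add: prod.remove)
  also have "\<dots> < ((1 + l k) / 2)\<^sup>2 * (\<Prod>i\<in>UNIV - {k}. ((1 + l i) / 2)\<^sup>2)"
    by (intro mult_less_le_imp_less amgm_k prod_mono conjI amgm) (auto simp: l_pos less_imp_le intro!: prod_pos)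
  also have "\<dots> = (\<Prod>i\<in>UNIV. ((1 + l i) / 2)\<^sup>2)" by (simp add: prod.remove)
  also have "\<dots> = (det ((1/2) *\<^sub>R (X + Y)))\<^sup>2 * ((det W)\<^sup>2)\<^sup>2"
    by (simp only: dm prod_power_distrib flip: power_mult_distrib)
  finally show ?thesis by (rule mult_right_less_imp_less) simp
qed

text \<open>The midpoint of two distinct maximizers stays in the convex set and would have a larger
  determinant. Positivity of the maximum makes both points positive definite, as strictness
  requires.\<close>

lemma det_maximizer_unique:
  fixes S :: "(real^'n^'n) set"
  assumes "convex S" "S \<subseteq> psd" "X \<in> S" "Y \<in> S"
    and max: "\<And>Z. Z \<in> S \<Longrightarrow> det Z \<le> det X" and "0 < det X" "det Y = det X"
  shows "Y = X"
proof (rule ccontr)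
  assume "Y \<noteq> X"
  have pd: "X \<in> pos_def" "Y \<in> pos_def" using assms psd_det_nonzero_imp_pos_def by force+
  let ?M = "(1/2) *\<^sub>R (X + Y)"
  have "?M \<in> S"
    using convexD[OF assms(1,3,4), of "1/2" "1/2"] by (simp add: scaleR_add_right)
  have "?M \<in> pos_def" using pd by (intro pos_def_scaleR pos_def_add_psd pos_def_imp_psd) auto
  from pos_def_det_pos[OF this] max[OF \<open>?M \<in> S\<close>] have "(det ?M)\<^sup>2 \<le> (det X)\<^sup>2"
    by (intro power_mono) auto
  with det_midpoint_strict[OF pd] \<open>Y \<noteq> X\<close> assms(7) show False by (simp add: power2_eq_square)
qed

section \<open>Block scalings and Fischer's inequality\<close>

text \<open>The value \<open>s = -1\<close> gives the reflection behind Fischer's inequality;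
  \<open>s = sqrt \<alpha>\<close> compensates the decay of the trailing block along the
  path.\<close>

definition scaling :: "'n set \<Rightarrow> real \<Rightarrow> real^'n^'n" where
  "scaling J s = (\<chi> i j. if i = j then if i \<in> J then 1 else s else 0)"

lemma scaling_congruence:
  "(scaling J s ** X ** scaling J s) $ i $ j
    = (if i \<in> J then 1 else s) * X $ i $ j * (if j \<in> J then 1 else s)"
  by (simp add: scaling_def matrix_matrix_mult_def if_distrib[where f="\<lambda>x. x * _"]
      if_distrib[where f="\<lambda>x. _ * x"] sum.delta sum.delta' cong: if_cong)

lemma transpose_scaling: "transpose (scaling J s) = scaling J s"
  by (auto simp: scaling_def transpose_def vec_eq_iff)

lemma det_scaling_nonzero: "s \<noteq> 0 \<Longrightarrow> det (scaling J s) \<noteq> 0"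
  by (simp add: scaling_def det_diagonal)

lemma linear_block: "linear (block J)"
  by (auto simp: linear_iff block_def vec_eq_iff)

text \<open>The block diagonal part of \<open>X\<close> is the midpoint of \<open>X\<close> and its conjugate under the
  reflection \<open>scaling J (-1)\<close>, which has the same determinant.\<close>

lemma fischer_inequality:
  fixes X :: "real^'n^'n"
  assumes X: "X \<in> pos_def"
  shows "det X \<le> det (block J X + block (- J) X)"
proof -
  let ?E = "scaling J (-1) :: real^'n^'n"
  let ?Y = "?E ** X ** ?E"
  have "?E ** ?E = mat 1"
    by (auto simp: scaling_def matrix_matrix_mult_def vec_eq_iff mat_def if_distrib[where f="\<lambda>x. x * _"]
      if_distrib[where f="\<lambda>x. _ * x"] sum.delta sum.delta' cong: if_cong)
  then have "det ?E * det ?E = 1" by (metis det_I det_mul)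
  then have dY: "det ?Y = det X" by (simp add: det_mul algebra_simps)
  have Y: "?Y \<in> pos_def"
    using pos_def_congruence[OF X det_scaling_nonzero[of "-1" J]] by (simp add: transpose_scaling)
  have mid: "(1/2) *\<^sub>R (X + ?Y) = block J X + block (- J) X"
    by (simp add: vec_eq_iff scaling_congruence block_def)
  show ?thesis
  proof (cases "X = ?Y")
    case True
    then have "block J X + block (- J) X = X" using mid by (simp flip: scaleR_2)
    then show ?thesis by simp
  next
    case False
    have "(det X)\<^sup>2 \<le> (det (block J X + block (- J) X))\<^sup>2"
      using det_midpoint_strict[OF X Y False] dY mid by (simp add: power2_eq_square)
    moreover have "block J X + block (- J) X \<in> pos_def"
      unfolding mid[symmetric] using X Y by (intro pos_def_scaleR pos_def_add_psd pos_def_imp_psd) auto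
    ultimately show ?thesis using pos_def_det_pos by (auto intro: power2_le_imp_le less_imp_le)
  qed
qed

section \<open>Perturbation of positive definite matrices and bounds from trivial recession
  cones\<close>

lemma norm_matrix_vector_le: "norm ((X::real^'n^'m) *v v) \<le> norm X * norm v"
proof -
  have "norm (X *v v) \<le> L2_set (\<lambda>i. norm (X $ i) * norm v) UNIV"
    unfolding norm_vec_def[of "X *v v"]
    by (rule L2_set_mono) (simp_all add: matrix_vector_mul_component Cauchy_Schwarz_ineq2)
  also have "\<dots> = norm X * norm v"
    by (simp add: norm_vec_def[of X] L2_set_left_distrib)
  finally show ?thesis .
qed

text \<open>A symmetric perturbation whose Frobenius norm is below the coercivity constant of
  \<open>X\<close> cannot make the form nonpositive at a nonzero vector.\<close>

lemma eventually_pos_def: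
  fixes X :: "real^'n^'n"
  assumes "X \<in> pos_def" "(f \<longlongrightarrow> X) F" "\<And>s. f s \<in> sym_mats"
  shows "\<forall>\<^sub>F s in F. f s \<in> pos_def"
proof -
  obtain c where c: "0 < c" "\<And>v. c * (norm v)\<^sup>2 \<le> v \<bullet> (X *v v)"
    using pos_def_coercive[OF assms(1)] by blast
  from tendstoD[OF assms(2) c(1)] have "\<forall>\<^sub>F s in F. norm (f s - X) < c" by (simp add: dist_norm)
  then show ?thesis
  proof eventually_elim
    case (elim s)
    have "0 < v \<bullet> (f s *v v)" if "v \<noteq> 0" for v
    proof -
      have "\<bar>v \<bullet> ((f s - X) *v v)\<bar> \<le> norm v * (norm (f s - X) * norm v)"
        by (rule order_trans[OF Cauchy_Schwarz_ineq2 mult_left_mono[OF norm_matrix_vector_le]]) simp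
      also have "\<dots> < c * (norm v)\<^sup>2"
        using elim that by (simp add: power2_eq_square)
      finally show ?thesis using c(2)[of v]
        by (simp add: matrix_vector_mult_diff_rdistrib inner_diff_right)
    qed
    then show ?case using assms(3) by (auto simp: pos_def_def)
  qed
qed

text \<open>The unit vectors of \<open>P\<close> form a compact set disjoint from the closed set
  \<open>L\<close>, hence at some distance \<open>d > 0\<close> from it; rescaling \<open>x\<close>
  to unit norm gives \<open>C = 1 / d\<close>. This bounds both \<open>slices\<close> and the
  perturbed feasible sets.\<close>

lemma cone_subspace_bound:
  fixes P L :: "'a::euclidean_space set"
  assumes "closed P" and cone: "\<And>c x. 0 \<le> c \<Longrightarrow> x \<in> P \<Longrightarrow> c *\<^sub>R x \<in> P"
    and L: "subspace L" and PL: "P \<inter> L \<subseteq> {0}"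
  obtains C where "\<And>x y. x \<in> P \<Longrightarrow> x - y \<in> L \<Longrightarrow> norm x \<le> C * norm y"
proof -
  have "compact (P \<inter> sphere 0 1)"
    using \<open>closed P\<close> by (simp add: closed_Int_compact)
  moreover have "P \<inter> sphere 0 1 \<inter> L = {}" using PL by force
  ultimately obtain d where d: "0 < d" "\<And>x y. x \<in> P \<inter> sphere 0 1 \<Longrightarrow> y \<in> L \<Longrightarrow> d \<le> dist x y"
    using separate_compact_closed[OF _ closed_subspace[OF L]] by metis
  have "norm x \<le> (1 / d) * norm y" if x: "x \<in> P" "x - y \<in> L" for x y
  proof (cases "x = 0")
    case False
    have "d \<le> dist ((1 / norm x) *\<^sub>R x) ((1 / norm x) *\<^sub>R (x - y))"
      using cone[OF _ x(1), of "1 / norm x"] subspace_scale[OF L x(2)] False by (intro d(2)) auto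
    also have "\<dots> = norm y / norm x"
      by (simp add: dist_norm algebra_simps)
    finally show ?thesis using d(1) False by (simp add: field_simps)
  qed (simp add: d(1) less_imp_le)
  then show thesis by (rule that)
qed

subsection \<open>Determinants of compressions and faces of the semidefinite cone\<close>

text \<open>The numbered matrix is padded by an identity block. Only permutations fixing every index
  outside \<open>J\<close> contribute to the padded determinant, and \<open>g\<close> carries them
  to permutations of \<open>{..<r}\<close> of the same sign.\<close>

lemma det_upto_eq_det:
  fixes K :: "nat \<Rightarrow> nat \<Rightarrow> real" and g :: "'n::finite \<Rightarrow> nat"
  assumes g: "bij_betw g J {..<r}"
  shows "det_upto r K
    = det (\<chi> i j. if i \<in> J \<and> j \<in> J then K (g i) (g j) else if i = j then 1 else 0)"
proof -
  let ?M = "\<chi> i j. if i \<in> J \<and> j \<in> J then K (g i) (g j) else if i = j then 1 else 0 :: real^'n^'n"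
  define f where "f = inv_into J g"
  have f: "bij_betw f {..<r} J" unfolding f_def by (rule bij_betw_inv_into[OF g])
  have fg: "f (g i) = i" if "i \<in> J" for i
    using g that by (simp add: f_def bij_betw_def)
  have gf: "g (f k) = k" if "k \<in> {..<r}" for k
    using g that by (simp add: f_def bij_betw_inv_into_right)
  have "det ?M = (\<Sum>p | p permutes UNIV. of_int (sign p) * (\<Prod>i\<in>UNIV. ?M $ i $ p i))"
    by (simp add: det_def)
  also have "\<dots> = (\<Sum>p | p permutes J. of_int (sign p) * (\<Prod>i\<in>UNIV. ?M $ i $ p i))"
  proof (rule sum.mono_neutral_right)
    show "\<forall>p\<in>{p. p permutes UNIV} - {p. p permutes J}. of_int (sign p) * (\<Prod>i\<in>UNIV. ?M $ i $ p i) = 0"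
    proof
      fix p assume "p \<in> {p. p permutes UNIV} - {p. p permutes J}"
      then obtain i where "i \<notin> J" "p i \<noteq> i" by (auto simp: permutes_def)
      then have "?M $ i $ p i = 0" by simp
      then show "of_int (sign p) * (\<Prod>i\<in>UNIV. ?M $ i $ p i) = 0"
        by (metis (no_types, lifting) UNIV_I finite mult_zero_right prod_zero)
    qed
  qed (auto simp: finite_permutations intro: permutes_subset)
  also have "\<dots> = det_upto r K"
    unfolding det_upto_def
  proof (rule sum.reindex_bij_witness[where i = "map_permutation {..<r} f" and j = "map_permutation J g"])
    fix p assume "p \<in> {p. p permutes J}"
    then have p: "p permutes J" by simp
    show "map_permutation {..<r} f (map_permutation J g p) = p"
      by (rule map_permutation_compose_inv[OF g p fg])
    show "map_permutation J g p \<in> {p. p permutes {..<r}}"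
      using map_permutation_permutes[OF g p] by simp
    have "sign (map_permutation J g p) = sign p"
      using g p by (simp add: sign_map_permutation bij_betw_def)
    moreover have "(\<Prod>k<r. K k (map_permutation J g p k)) = (\<Prod>i\<in>UNIV. ?M $ i $ p i)"
    proof -
      have "(\<Prod>k<r. K k (map_permutation J g p k)) = (\<Prod>i\<in>J. K (g i) (map_permutation J g p (g i)))"
        by (rule prod.reindex_bij_betw[OF g, symmetric])
      also have "\<dots> = (\<Prod>i\<in>J. ?M $ i $ p i)"
        using g permutes_in_image[OF p]
        by (intro prod.cong) (auto simp: map_permutation_apply bij_betw_def)
      also have "\<dots> = (\<Prod>i\<in>UNIV. ?M $ i $ p i)"
        by (rule prod.mono_neutral_left) (auto simp: permutes_not_in[OF p])
      finally show ?thesis .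
    qed
    ultimately show "of_int (sign (map_permutation J g p)) * (\<Prod>k<r. K k (map_permutation J g p k))
        = of_int (sign p) * (\<Prod>i\<in>UNIV. ?M $ i $ p i)" by simp
  next
    fix p assume "p \<in> {p. p permutes {..<r}}"
    then have p: "p permutes {..<r}" by simp
    show "map_permutation J g (map_permutation {..<r} f p) = p"
      by (rule map_permutation_compose_inv[OF f p gf])
    show "map_permutation {..<r} f p \<in> {p. p permutes J}"
      using map_permutation_permutes[OF f p] by simp
  qed
  finally show ?thesis ..
qed

lemma psd_on_component: "X \<in> psd_on J \<Longrightarrow> i \<notin> J \<or> j \<notin> J \<Longrightarrow> X $ i $ j = 0"
  by (auto simp: psd_on_def)

lemma psd_on_imp_psd: "X \<in> psd_on J \<Longrightarrow> X \<in> psd"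
  by (simp add: psd_on_def)

lemma block_unit_component: "block J (mat 1) $ i $ j = (if i = j then if i \<in> J then 1 else 0 else 0)"
  by (simp add: block_def mat_def)

lemma block_unit_mult: "block J (mat 1) *v v = (\<chi> i. if i \<in> J then v $ i else 0)"
  by (simp add: vec_eq_iff matrix_vector_mult_def block_unit_component
      if_distrib[where f="\<lambda>x. x * _"] cong: if_cong)

text \<open>Completing the columns of \<open>V\<close> by the unit vectors outside \<open>J\<close>
  gives an invertible \<open>W\<close>, and congruence by \<open>W\<close> only multiplies the
  determinant by the square of \<open>det W\<close>. Hence the choice of \<open>V\<close> does not
  affect which point is the maximizer.\<close>

lemma det_upto_compression:
  fixes V :: "nat \<Rightarrow> real^'n" and J :: "'n set"
  assumes span_V: "span (V ` {..<card J}) = {x. \<forall>i. i \<notin> J \<longrightarrow> x $ i = 0}"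
  obtains c where "0 < c"
    "\<And>X. X \<in> psd_on J \<Longrightarrow>
      det_upto (card J) (\<lambda>i j. V i \<bullet> (X *v V j)) = c * det (X + block (- J) (mat 1))"
proof -
  obtain g where g: "bij_betw g J {..<card J}"
    using ex_bij_betw_finite_nat[of J] by (auto simp: atLeast0LessThan)
  define W :: "real^'n^'n" where "W = (\<chi> i j. if j \<in> J then V (g j) $ i else if i = j then 1 else 0)"
  have colW: "column j W = (if j \<in> J then V (g j) else axis j 1)" for j
    by (simp add: W_def column_def axis_def vec_eq_iff)
  have V0: "V k $ i = 0" if "k < card J" "i \<notin> J" for k i
    using span_base[of "V k" "V ` {..<card J}"] that unfolding span_V by auto
  have "V ` {..<card J} \<subseteq> columns W"
  proof
    fix v assume "v \<in> V ` {..<card J}"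
    then obtain k where "k < card J" "v = V k" by auto
    moreover obtain j where "j \<in> J" "g j = k"
      using g \<open>k < card J\<close> by (metis bij_betw_def imageE lessThan_iff)
    ultimately have "v = column j W" by (simp add: colW)
    then show "v \<in> columns W" by (auto simp: columns_def)
  qed
  \<comment> \<open>The columns span the coordinate subspace of \<open>J\<close> by assumption and
    include the remaining unit vectors, so they span everything.\<close>
  from span_mono[OF this] have sub: "{x. \<forall>i. i \<notin> J \<longrightarrow> x $ i = 0} \<subseteq> span (columns W)"
    by (simp add: span_V)
  have axis: "axis j 1 \<in> span (columns W)" for j
  proof (cases "j \<in> J")
    case True
    then show ?thesis using sub by (auto simp: axis_def)
  next
    case False
    then have "axis j 1 = column j W" by (simp add: colW)
    then show ?thesis by (intro span_base) (auto simp: columns_def)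
  qed
  have "x \<in> span (columns W)" for x
  proof -
    have "x = (\<Sum>i\<in>UNIV. x $ i *\<^sub>R axis i 1)"
      by (simp add: vec_eq_iff axis_def if_distrib[where f="\<lambda>x. _ * x"] sum.delta' cong: if_cong)
    also have "\<dots> \<in> span (columns W)" by (intro span_sum span_scale axis)
    finally show ?thesis .
  qed
  then have "span (columns W) = UNIV" by auto
  then have dW: "det W \<noteq> 0"
    by (metis invertible_det_nz invertible_right_inverse matrix_right_invertible_span_columns span_vec_eq)
  have "det_upto (card J) (\<lambda>i j. V i \<bullet> (X *v V j)) = (det W)\<^sup>2 * det (X + block (- J) (mat 1))"
    if X: "X \<in> psd_on J" for X
  proof -
    have "transpose W ** (X + block (- J) (mat 1)) ** W
      = (\<chi> i j. if i \<in> J \<and> j \<in> J then V (g i) \<bullet> (X *v V (g j)) else if i = j then 1 else 0)"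
      (is "?L = ?R")
    proof -
      have gJ: "g i < card J" if "i \<in> J" for i using g that by (auto simp: bij_betw_def)
      have axis_nth: "axis i 1 $ j = (if j = i then 1 else 0)" for i j :: 'n by (simp add: axis_def)
      have unit: "block (- J) (mat 1) *v column j W = (if j \<in> J then 0 else axis j 1)" for j
        by (auto simp: block_unit_mult colW vec_eq_iff axis_def V0 gJ)
      have Xax: "X *v axis j 1 = 0" if "j \<notin> J" for j
        using psd_on_component[OF X] that
        by (simp add: vec_eq_iff matrix_vector_mul_component inner_axis)
      have axX: "(X *v v) $ i = 0" if "i \<notin> J" for i v
      proof -
        have "X $ i = 0" using psd_on_component[OF X] that by (simp add: vec_eq_iff)
        then show ?thesis by (simp add: matrix_vector_mul_component)
      qed
      have "?L $ i $ j = ?R $ i $ j" for i j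
        unfolding congruence_component matrix_vector_mult_add_rdistrib unit
        using V0 gJ by (auto simp: colW inner_add_right Xax axX inner_axis inner_axis' axis_nth)
      then show ?thesis by (simp add: vec_eq_iff)
    qed
    from arg_cong[OF this, of det] show ?thesis
      unfolding det_upto_eq_det[OF g] by (simp add: det_mul power2_eq_square mult_ac)
  qed
  then show thesis using that[of "(det W)\<^sup>2"] dW by simp
qed

text \<open>\<open>X + S\<close> is the product of the two padded matrices, because products of
  matrices with complementary supports vanish. This separates the maximization over the leading
  block from that over the trailing block.\<close>

lemma det_complementary_blocks:
  fixes X S :: "real^'n^'n"
  assumes X: "X \<in> psd_on J" and S: "S \<in> psd_on (- J)"
  shows "det (X + S) = det (X + block (- J) (mat 1)) * det (block J (mat 1) + S)"
proof -
  have 1: "X ** block J (mat 1) = X"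
    using psd_on_component[OF X]
    by (simp add: vec_eq_iff matrix_matrix_mult_def block_unit_component
      if_distrib[where f="\<lambda>x. _ * x"] cong: if_cong)
  have 2: "block (- J) (mat 1) ** S = S"
    using psd_on_component[OF S]
    by (simp add: vec_eq_iff matrix_matrix_mult_def block_unit_component
      if_distrib[where f="\<lambda>x. x * _"] cong: if_cong)
  have 3: "X ** S = 0"
    using psd_on_component[OF X] psd_on_component[OF S]
    by (auto simp: vec_eq_iff matrix_matrix_mult_def intro!: sum.neutral) blast
  have 4: "block (- J) (mat 1) ** block J (mat 1) = (0 :: real^'n^'n)"
    by (auto simp: vec_eq_iff matrix_matrix_mult_def block_def intro!: sum.neutral)
  have rdistrib: "(A + B) ** C = A ** C + B ** C" for A B C :: "real^'n^'n"
    by (simp add: vec_eq_iff matrix_matrix_mult_def sum.distrib distrib_right)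
  have "X + S = (X + block (- J) (mat 1)) ** (block J (mat 1) + S)"
    by (simp add: matrix_add_ldistrib rdistrib 1 2 3 4)
  then show ?thesis by (metis det_mul)
qed

section \<open>The semidefinite cone and its block truncations\<close>

lemma closed_psd: "closed (psd :: (real^'n^'n) set)"
proof -
  have eq: "psd = (\<Inter>i. \<Inter>j. {X. X $ i $ j = X $ j $ i}) \<inter> (\<Inter>v. {X :: real^'n^'n. 0 \<le> v \<bullet> (X *v v)})"
    by (auto simp: psd_def sym_mats_iff)
  have cont: "continuous_on UNIV (\<lambda>X :: real^'n^'n. v \<bullet> (X *v v))" for v
    unfolding inner_vec_def matrix_vector_mult_def by (simp, intro continuous_intros)
  show ?thesis unfolding eq
    by (intro closed_Int closed_INT ballI closed_Collect_eq closed_Collect_le cont)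
      (intro continuous_intros)+
qed

lemma psd_add: "X \<in> psd \<Longrightarrow> Y \<in> psd \<Longrightarrow> X + Y \<in> psd"
  unfolding psd_def
  by (auto simp: matrix_vector_mult_add_rdistrib inner_add_right subspace_add[OF subspace_sym_mats])

lemma psd_scaleR: "X \<in> psd \<Longrightarrow> 0 \<le> c \<Longrightarrow> c *\<^sub>R X \<in> psd"
  unfolding psd_def
  by (auto simp: subspace_scale[OF subspace_sym_mats] simp flip: scaleR_matrix_vector_assoc)

lemma convex_psd: "convex psd"
  by (auto simp: convex_def intro!: psd_add psd_scaleR)

lemma block_psd_on:
  assumes "X \<in> psd"
  shows "block J X \<in> psd_on J"
proof -
  \<comment> \<open>The form of the block is the form of \<open>X\<close> at the vector truncated to
    \<open>J\<close>.\<close>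
  have "v \<bullet> (block J X *v v) = (\<chi> i. if i \<in> J then v $ i else 0) \<bullet> (X *v (\<chi> i. if i \<in> J then v $ i else 0))" for v
    unfolding inner_vec_def matrix_vector_mult_def block_def
    by (auto simp: sum_distrib_left intro!: sum.cong)
  then show ?thesis using assms
    by (auto simp: psd_on_def psd_def sym_mats_iff block_def)
qed

lemma block_psd_on_eq: "X \<in> psd_on J \<Longrightarrow> block J X = X"
  by (auto simp: vec_eq_iff block_def psd_on_component)

lemma block_psd_on_compl: "X \<in> psd_on J \<Longrightarrow> block (- J) X = 0"
  by (auto simp: vec_eq_iff block_def psd_on_component)

lemma closed_psd_on: "closed (psd_on J)"
proof -
  have eq: "psd_on J = psd \<inter> (\<Inter>i. \<Inter>j\<in>{j. i \<notin> J \<or> j \<notin> J}. {X. X $ i $ j = 0})"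
    by (auto simp: psd_on_def)
  show ?thesis unfolding eq
    by (intro closed_Int closed_psd closed_INT ballI closed_Collect_eq continuous_intros)
qed

section \<open>Faces, kernels and relative interior points\<close>

text \<open>Two nonnegative forms whose sum vanishes at \<open>v\<close> both vanish there, and
  \<open>psd_kernel\<close> then puts \<open>v\<close> into both kernels.\<close>

lemma psd_face_kernel: "psd_face {Y \<in> psd. \<forall>v. R *v v = 0 \<longrightarrow> Y *v v = 0}"
  (is "psd_face ?f")
proof -
  have eq: "?f = psd \<inter> (\<Inter>v\<in>{v. R *v v = 0}. {Y. Y *v v = 0})" by auto
  have "continuous_on UNIV (\<lambda>X :: real^'n^'n. X *v v)" for v
    unfolding matrix_vector_mult_def by (intro continuous_intros)
  then have "closed ?f" unfolding eq
    by (intro closed_Int closed_psd closed_INT ballI closed_Collect_eq continuous_intros)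
  moreover have "convex_cone ?f"
  proof -
    have "0 \<in> ?f" by (auto simp: psd_def sym_mats_iff)
    then show ?thesis unfolding convex_cone_iff
      by (auto simp: psd_add psd_scaleR matrix_vector_mult_add_rdistrib simp flip: scaleR_matrix_vector_assoc)
  qed
  moreover have summand: "X \<in> ?f" if XY: "X \<in> psd" "Y \<in> psd" "X + Y \<in> ?f" for X Y
  proof -
    have "X *v v = 0" if "R *v v = 0" for v
    proof (rule psd_kernel[OF XY(1)])
      have "(X + Y) *v v = 0" using XY(3) that by auto
      then have "v \<bullet> (X *v v) + v \<bullet> (Y *v v) = 0"
        by (metis inner_add_right inner_zero_right matrix_vector_mult_add_rdistrib)
      moreover have "0 \<le> v \<bullet> (X *v v)" "0 \<le> v \<bullet> (Y *v v)" using XY by (auto simp: psd_def)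
      ultimately show "v \<bullet> (X *v v) = 0" by linarith
    qed
    then show ?thesis using XY by auto
  qed
  moreover have "X \<in> ?f \<and> Y \<in> ?f" if "X \<in> psd" "Y \<in> psd" "X + Y \<in> ?f" for X Y
    using summand[OF that] summand[OF that(2,1)] that(3) by (simp only: add.commute)
  ultimately show ?thesis unfolding psd_face_def by blast
qed

lemma subset_min_face: "F \<subseteq> min_face F"
  by (auto simp: min_face_def)

text \<open>A relative interior point has the smallest kernel in \<open>F\<close>, so
  \<open>F\<close> lies in the face of matrices vanishing on the kernel of \<open>R\<close>.
  Minimality puts \<open>block J (mat 1)\<close> into that face, so kernel vectors of
  \<open>R\<close> vanish on \<open>J\<close>.\<close>

lemma rel_interior_min_face:
  fixes F :: "(real^'n^'n) set"
  assumes F: "F \<subseteq> psd" "convex F" and R: "R \<in> rel_interior F" and mf: "min_face F = psd_on J"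
  shows "R + block (- J) (mat 1) \<in> pos_def"
    and "range (\<lambda>x. R *v x) = {x. \<forall>i. i \<notin> J \<longrightarrow> x $ i = 0}"
proof -
  let ?E = "block (- J) (mat 1) :: real^'n^'n"
  have RF: "R \<in> F" using R rel_interior_subset by blast
  then have RJ: "R \<in> psd_on J" using subset_min_face[of F] mf by auto
  have kernel: "X *v v = 0" if X: "X \<in> F" and v: "R *v v = 0" for X v
  proof -
    \<comment> \<open>The segment from \<open>X\<close> to \<open>R\<close> extends beyond
      \<open>R\<close> inside \<open>F\<close>; the negative weight \<open>1 - e\<close> on
      \<open>X\<close> forces its form at \<open>v\<close> to be nonpositive.\<close>
    obtain e where e: "e > 1" "(1 - e) *\<^sub>R X + e *\<^sub>R R \<in> F"
      using R X convex_rel_interior_iff[OF F(2)] by blast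
    then have "0 \<le> v \<bullet> (((1 - e) *\<^sub>R X + e *\<^sub>R R) *v v)" using F(1) by (auto simp: psd_def)
    then have "0 \<le> (1 - e) * (v \<bullet> (X *v v))"
      by (simp add: matrix_vector_mult_add_rdistrib inner_add_right v flip: scaleR_matrix_vector_assoc)
    moreover have "0 \<le> v \<bullet> (X *v v)" and psd: "X \<in> psd" using X F(1) by (auto simp: psd_def)
    ultimately have "v \<bullet> (X *v v) = 0" using e(1) by (auto simp: zero_le_mult_iff)
    then show ?thesis by (rule psd_kernel[OF psd])
  qed
  have "psd_on J \<subseteq> {Y \<in> psd. \<forall>v. R *v v = 0 \<longrightarrow> Y *v v = 0}"
    unfolding mf[symmetric] min_face_def
    by (rule Inter_lower) (use psd_face_kernel[of R] F(1) kernel in auto)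
  moreover have "block J (mat 1) \<in> psd_on J"
    by (intro block_psd_on pos_def_imp_psd mat_1_pos_def)
  ultimately have ker: "block J (mat 1) *v v = 0" if "R *v v = 0" for v using that by blast
  have Epsd: "?E \<in> psd"
    by (rule psd_on_imp_psd[OF block_psd_on[OF pos_def_imp_psd[OF mat_1_pos_def]]])
  have REpsd: "R + ?E \<in> psd" using psd_add[OF psd_on_imp_psd[OF RJ] Epsd] .
  have "0 < v \<bullet> ((R + ?E) *v v)" if "v \<noteq> 0" for v
  proof (rule ccontr)
    assume "\<not> ?thesis"
    moreover have "0 \<le> v \<bullet> (R *v v)" "0 \<le> v \<bullet> (?E *v v)"
      using RJ Epsd by (auto simp: psd_on_def psd_def)
    ultimately have "v \<bullet> (R *v v) = 0" "v \<bullet> (?E *v v) = 0"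
      by (auto simp: matrix_vector_mult_add_rdistrib inner_add_right)
    then have "R *v v = 0" "?E *v v = 0" using psd_kernel Epsd RJ by (auto simp: psd_on_def)
    with ker[of v] have "block J (mat 1) *v v = 0" "?E *v v = 0" by auto
    then have "v = 0" unfolding block_unit_mult
      by (simp add: vec_eq_iff) metis
    with that show False by simp
  qed
  then show pd: "R + ?E \<in> pos_def" using REpsd by (auto simp: pos_def_def psd_def)
  show "range (\<lambda>x. R *v x) = {x. \<forall>i. i \<notin> J \<longrightarrow> x $ i = 0}"
  proof (intro equalityI subsetI)
    fix x assume "x \<in> range (\<lambda>x. R *v x)"
    then show "x \<in> {x. \<forall>i. i \<notin> J \<longrightarrow> x $ i = 0}"
      using psd_on_component[OF RJ] by (auto simp: matrix_vector_mult_def)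
  next
    fix x :: "real^'n" assume x: "x \<in> {x. \<forall>i. i \<notin> J \<longrightarrow> x $ i = 0}"
    have "det (R + ?E) \<noteq> 0" using pos_def_det_pos[OF pd] by simp
    then obtain B where "(R + ?E) ** B = mat 1" using invertible_det_nz invertible_def by blast
    then have y: "(R + ?E) *v (B *v x) = x" by (simp add: matrix_vector_mul_assoc)
    \<comment> \<open>Outside \<open>J\<close> both \<open>x\<close> and the image of
      \<open>R\<close> vanish, so the \<open>?E\<close> part vanishes there too, and
      \<open>R\<close> alone maps \<open>B *v x\<close> to \<open>x\<close>.\<close>
    have "(?E *v (B *v x)) $ i = 0" for i
    proof (cases "i \<in> J")
      case False
      have "(R *v (B *v x)) $ i = 0" using psd_on_component[OF RJ] False
        by (simp add: matrix_vector_mult_def)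
      then show ?thesis using arg_cong[OF y, of "\<lambda>v. v $ i"] x False
        by (simp add: matrix_vector_mult_add_rdistrib)
    qed (simp add: block_unit_mult)
    then have "?E *v (B *v x) = 0" by (simp add: vec_eq_iff)
    with y have "R *v (B *v x) = x" by (simp add: matrix_vector_mult_add_rdistrib)
    then show "x \<in> range (\<lambda>x. R *v x)" by (metis rangeI)
  qed
qed

text \<open>A positive maximum stays clear of the value \<open>-\<infinity>\<close>, and the
  logarithm is strictly increasing on positive numbers; so maximizing \<open>eln\<close> of
  \<open>d\<close> amounts to maximizing \<open>d\<close>.\<close>

lemma THE_is_arg_max_eln:
  assumes "x \<in> S" "0 < d x" "\<And>y. y \<in> S \<Longrightarrow> d y \<le> d x" "\<And>y. y \<in> S \<Longrightarrow> d y = d x \<Longrightarrow> y = x"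
  shows "(THE y. is_arg_max (\<lambda>y. eln (d y)) (\<lambda>y. y \<in> S) y) = x"
proof (rule the_equality)
  show "is_arg_max (\<lambda>y. eln (d y)) (\<lambda>y. y \<in> S) x"
    using assms(1-3) by (fastforce simp: is_arg_max_def eln_def not_less)
next
  fix y assume "is_arg_max (\<lambda>y. eln (d y)) (\<lambda>y. y \<in> S) y"
  then have "y \<in> S" "\<not> eln (d x) > eln (d y)" using assms(1) by (auto simp: is_arg_max_def)
  then have "d x \<le> d y" using assms(2) by (auto simp: eln_def split: if_splits)
  with assms(3,4)[OF \<open>y \<in> S\<close>] show "y = x" by simp
qed

lemma continuous_on_det: "continuous_on S (det :: real^'n^'n \<Rightarrow> real)"
  unfolding det_def by (intro continuous_intros)

subsection \<open>Convergence of the parametric path\<close>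

text \<open>If convergence failed along a sequence, some subsequence would stay at distance at least
  \<open>e\<close> from \<open>l\<close>, and none of its subsequences could converge to
  \<open>l\<close>.\<close>

lemma tendsto_at_right_subseq:
  fixes f :: "real \<Rightarrow> 'a::metric_space"
  assumes "\<And>a. (\<And>k. 0 < a k) \<Longrightarrow> a \<longlonglongrightarrow> 0 \<Longrightarrow> \<exists>r. strict_mono (r :: nat \<Rightarrow> nat) \<and> (f \<circ> a \<circ> r) \<longlonglongrightarrow> l"
  shows "(f \<longlongrightarrow> l) (at_right 0)"
  unfolding tendsto_at_iff_sequentially
proof (intro allI impI)
  fix a :: "nat \<Rightarrow> real" assume a: "\<forall>k. a k \<in> {0<..} - {0}" "a \<longlonglongrightarrow> 0"
  show "(f \<circ> a) \<longlonglongrightarrow> l"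
  proof (rule ccontr)
    assume "\<not> (f \<circ> a) \<longlonglongrightarrow> l"
    then obtain e where e: "0 < e" "\<not> (\<forall>\<^sub>F k in sequentially. dist ((f \<circ> a) k) l < e)"
      by (auto simp: tendsto_iff)
    then have "infinite {k. \<not> dist ((f \<circ> a) k) l < e}"
      by (simp add: frequently_cofinite[symmetric] not_eventually cofinite_eq_sequentially)
    then obtain s :: "nat \<Rightarrow> nat" where s: "strict_mono s" "\<And>k. \<not> dist ((f \<circ> a) (s k)) l < e"
      using infinite_enumerate by blast
    have "(a \<circ> s) \<longlonglongrightarrow> 0" using LIMSEQ_subseq_LIMSEQ[OF a(2) s(1)] .
    then obtain r :: "nat \<Rightarrow> nat" where "(f \<circ> (a \<circ> s) \<circ> r) \<longlonglongrightarrow> l" using assms[of "a \<circ> s"] a(1) by auto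
    from tendstoD[OF this e(1)] have "\<forall>\<^sub>F k in sequentially. False"
      using s(2) by (simp add: o_def)
    then show False by simp
  qed
qed

lemma spectrahedron_convex:
  assumes "linear \<A>" shows "convex (spectrahedron \<A> b)"
proof -
  have "spectrahedron \<A> b = psd \<inter> \<A> -` {b}" by (auto simp: spectrahedron_def)
  then show ?thesis by (simp add: convex_Int convex_psd convex_linear_vimage[OF assms])
qed

lemma spectrahedron_closed:
  fixes \<A> :: "real^'n^'n \<Rightarrow> real^'m"
  assumes "linear \<A>" shows "closed (spectrahedron \<A> b)"
proof -
  have eq: "spectrahedron \<A> b = psd \<inter> {X. \<A> X = b}" by (auto simp: spectrahedron_def)
  show ?thesis unfolding eq
    by (intro closed_Int closed_psd closed_Collect_eq linear_continuous_on continuous_intros)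
      (use assms in \<open>simp add: linear_linear\<close>)
qed

lemma subspace_null_space: "linear \<A> \<Longrightarrow> subspace (null_space \<A>)"
  using subspace_sym_mats
  by (auto simp: null_space_def subspace_def linear_0 linear_add linear_scale)

text \<open>Isolates what the convergence argument takes from faces and from the basis of the null
  space. Adding the trailing identity in \<open>face_interior\<close> expresses positive
  definiteness of the leading block.\<close>

locale facial_spectrahedron =
  fixes \<A> :: "real^'n^'n \<Rightarrow> real^'m" and b :: "real^'m" and J :: "'n set"
  assumes linear: "linear \<A>"
    and bounded: "bounded (spectrahedron \<A> b)"
    and on_face: "spectrahedron \<A> b \<subseteq> psd_on J"
    and blocks: "block (- J) ` null_space \<A> \<inter> psd_on (- J) \<subseteq> {0}"
    and face_interior: "\<exists>X \<in> spectrahedron \<A> b. X + block (- J) (mat 1) \<in> pos_def"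
begin

abbreviation E :: "real^'n^'n" where "E \<equiv> block (- J) (mat 1)"

abbreviation F :: "(real^'n^'n) set" where "F \<equiv> spectrahedron \<A> b"

abbreviation perturbed :: "real \<Rightarrow> (real^'n^'n) set" where
  "perturbed \<alpha> \<equiv> spectrahedron \<A> (b + \<alpha> *\<^sub>R \<A> (mat 1))"

text \<open>This is the set \<open>K\<close> of the outline, with \<open>E\<close> as the trailing
  identity block.\<close>

definition slices :: "(real^'n^'n) set" where
  "slices = {S \<in> psd_on (- J). S - E \<in> block (- J) ` null_space \<A>}"

lemma subspace_blocks: "subspace (block (- J) ` null_space \<A>)"
  by (rule linear_subspace_image[OF linear_block subspace_null_space[OF linear]])

lemma E_in_slices: "E \<in> slices"
  using block_psd_on[OF pos_def_imp_psd[OF mat_1_pos_def]] subspace_0[OF subspace_blocks]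
  by (simp add: slices_def)

lemma compact_F: "compact F"
  using bounded spectrahedron_closed[OF linear] by (simp add: compact_eq_bounded_closed)

lemma slices_compact: "compact slices"
proof -
  have cone: "c *\<^sub>R X \<in> psd_on (- J)" if "0 \<le> c" "X \<in> psd_on (- J)" for c :: real and X :: "real^'n^'n"
    using that by (auto simp: psd_on_def psd_scaleR)
  have "psd_on (- J) \<inter> block (- J) ` null_space \<A> \<subseteq> {0}" using blocks by blast
  from cone_subspace_bound[OF closed_psd_on cone subspace_blocks this]
  obtain C where C: "\<And>x y. x \<in> psd_on (- J) \<Longrightarrow> x - y \<in> block (- J) ` null_space \<A> \<Longrightarrow> norm x \<le> C * norm y"
    by blast
  then have "norm S \<le> C * norm E" if "S \<in> slices" for S
    using that by (simp add: slices_def)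
  then have "bounded slices" by (auto simp: bounded_iff)
  moreover have eq: "slices = psd_on (- J) \<inter> (\<lambda>S. S - E) -` (block (- J) ` null_space \<A>)"
    by (auto simp: slices_def)
  have "closed slices" unfolding eq
    by (intro closed_Int closed_psd_on closed_vimage closed_subspace subspace_blocks continuous_intros)
  ultimately show ?thesis by (simp add: compact_eq_bounded_closed)
qed

lemma slices_convex: "convex slices"
proof (rule convexI)
  fix S T :: "real^'n^'n" and u v :: real
  assume ST: "S \<in> slices" "T \<in> slices" and uv: "0 \<le> u" "0 \<le> v" "u + v = 1"
  have "u *\<^sub>R (S - E) + v *\<^sub>R (T - E) \<in> block (- J) ` null_space \<A>"
    using ST by (intro subspace_add subspace_scale subspace_blocks) (auto simp: slices_def)
  moreover have "u *\<^sub>R (S - E) + v *\<^sub>R (T - E) = u *\<^sub>R S + v *\<^sub>R T - (u + v) *\<^sub>R E"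
    by (simp add: algebra_simps)
  moreover have "u *\<^sub>R S + v *\<^sub>R T \<in> psd_on (- J)"
    using ST uv by (auto simp: slices_def psd_on_def intro!: psd_add psd_scaleR)
  ultimately show "u *\<^sub>R S + v *\<^sub>R T \<in> slices" by (simp add: slices_def uv(3))
qed

text \<open>A bounded \<open>F\<close> admits no nonzero semidefinite direction in the null space,
  so \<open>cone_subspace_bound\<close> controls \<open>X\<close> by the particular solution
  \<open>X0\<close> plus \<open>\<alpha>\<close> times the identity.\<close>

lemma perturbed_bound:
  obtains C where "\<And>X \<alpha>. X \<in> perturbed \<alpha> \<Longrightarrow> norm X \<le> C * (1 + \<bar>\<alpha>\<bar>)"
proof -
  obtain X0 where X0: "X0 \<in> F" using face_interior by blast
  obtain B where B: "\<And>X. X \<in> F \<Longrightarrow> norm X \<le> B" using bounded by (auto simp: bounded_iff)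
  have PL: "psd \<inter> null_space \<A> \<subseteq> {0}"
  proof
    fix D assume D: "D \<in> psd \<inter> null_space \<A>"
    have "D = 0"
    proof (rule ccontr)
      assume "D \<noteq> 0"
      \<comment> \<open>This gives \<open>t *\<^sub>R D\<close> the norm
        \<open>B + norm X0 + 1\<close>, one more than membership of
        \<open>X0 + t *\<^sub>R D\<close> in \<open>F\<close> allows.\<close>
      define t where "t = (B + norm X0 + 1) / norm D"
      have "0 \<le> B" using B[OF X0] norm_ge_zero order_trans by blast
      then have t: "0 \<le> t" by (simp add: t_def)
      then have "X0 + t *\<^sub>R D \<in> F" using X0 D linear
        by (auto simp: spectrahedron_def null_space_def linear_add linear_scale intro!: psd_add psd_scaleR)
      from B[OF this] have "norm (t *\<^sub>R D) \<le> B + norm X0"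
        using norm_triangle_ineq4[of "X0 + t *\<^sub>R D" X0] by simp
      then show False using \<open>D \<noteq> 0\<close> t by (simp add: t_def)
    qed
    then show "D \<in> {0}" by simp
  qed
  obtain C where C: "\<And>x y. x \<in> psd \<Longrightarrow> x - y \<in> null_space \<A> \<Longrightarrow> norm x \<le> C * norm y"
    using cone_subspace_bound[OF closed_psd _ subspace_null_space[OF linear] PL] psd_scaleR by metis
  have "norm X \<le> (\<bar>C\<bar> * (norm X0 + norm (mat 1 :: real^'n^'n))) * (1 + \<bar>\<alpha>\<bar>)" if X: "X \<in> perturbed \<alpha>" for X \<alpha>
  proof -
    let ?I = "mat 1 :: real^'n^'n"
    have "X - (X0 + \<alpha> *\<^sub>R ?I) \<in> null_space \<A>"
      using X X0 linear mat_1_pos_def subspace_sym_mats unfolding null_space_def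
      by (auto simp: spectrahedron_def psd_def pos_def_def linear_add linear_scale linear_diff
          intro!: subspace_diff subspace_add subspace_scale)
    then have "norm X \<le> C * norm (X0 + \<alpha> *\<^sub>R ?I)" using X by (intro C) (auto simp: spectrahedron_def)
    also have "\<dots> \<le> \<bar>C\<bar> * (norm X0 + \<bar>\<alpha>\<bar> * norm ?I)"
      by (intro mult_mono norm_triangle_le) auto
    also have "\<dots> \<le> \<bar>C\<bar> * ((norm X0 + norm ?I) * (1 + \<bar>\<alpha>\<bar>))"
      by (intro mult_left_mono) (auto simp: algebra_simps)
    finally show ?thesis by (simp add: mult.assoc)
  qed
  then show thesis by (rule that)
qed

text \<open>\<open>X - X0 - \<alpha> *\<^sub>R mat 1\<close> lies in the null space and
  \<open>X0\<close> has zero trailing block, so the rescaled trailing block of \<open>X\<close>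
  differs from \<open>E\<close> by a trailing block of the null space.\<close>

lemma perturbed_slice:
  assumes X: "X \<in> perturbed \<alpha>" and "0 < \<alpha>"
  shows "(1 / \<alpha>) *\<^sub>R block (- J) X \<in> slices"
proof -
  obtain X0 where X0: "X0 \<in> F" using face_interior by blast
  have "X - X0 - \<alpha> *\<^sub>R mat 1 \<in> null_space \<A>"
    using X X0 linear mat_1_pos_def subspace_sym_mats unfolding null_space_def
    by (auto simp: spectrahedron_def psd_def pos_def_def linear_scale linear_diff
        intro!: subspace_diff subspace_scale)
  then have "(1 / \<alpha>) *\<^sub>R block (- J) (X - X0 - \<alpha> *\<^sub>R mat 1) \<in> block (- J) ` null_space \<A>"
    by (intro subspace_scale[OF subspace_blocks]) simp
  moreover have "block (- J) X0 = 0" using X0 on_face block_psd_on_compl by blast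
  then have "(1 / \<alpha>) *\<^sub>R block (- J) (X - X0 - \<alpha> *\<^sub>R mat 1) = (1 / \<alpha>) *\<^sub>R block (- J) X - E"
    using \<open>0 < \<alpha>\<close>
    by (simp add: linear_diff[OF linear_block] linear_scale[OF linear_block] scaleR_diff_right)
  moreover have "(1 / \<alpha>) *\<^sub>R block (- J) X \<in> psd_on (- J)"
    using block_psd_on[of X "- J"] X \<open>0 < \<alpha>\<close> by (auto simp: psd_on_def spectrahedron_def psd_scaleR)
  ultimately show ?thesis by (simp add: slices_def)
qed

lemma path_point_maximizes:
  assumes "0 < \<alpha>"
  shows "path_point \<A> b \<alpha> \<in> perturbed \<alpha>" "path_point \<A> b \<alpha> \<in> pos_def"
    and "\<And>X. X \<in> perturbed \<alpha> \<Longrightarrow> det X \<le> det (path_point \<A> b \<alpha>)"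
proof -
  obtain X0 where X0: "X0 \<in> F" using face_interior by blast
  \<comment> \<open>A positive definite feasible point: it makes the maximal determinant positive,
    so that the maximizer is unique and \<open>THE\<close> selects it.\<close>
  let ?Y = "\<alpha> *\<^sub>R mat 1 + X0"
  have Y: "?Y \<in> perturbed \<alpha>" "?Y \<in> pos_def"
    using pos_def_add_psd[OF pos_def_scaleR[OF mat_1_pos_def assms], of X0] X0 linear
    by (auto simp: spectrahedron_def linear_add linear_scale intro: pos_def_imp_psd)
  obtain C where "\<And>X. X \<in> perturbed \<alpha> \<Longrightarrow> norm X \<le> C * (1 + \<bar>\<alpha>\<bar>)" using perturbed_bound by metis
  then have "compact (perturbed \<alpha>)"
    using spectrahedron_closed[OF linear] by (auto simp: compact_eq_bounded_closed bounded_iff)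
  then obtain M where M: "M \<in> perturbed \<alpha>" "\<And>X. X \<in> perturbed \<alpha> \<Longrightarrow> det X \<le> det M"
    using continuous_attains_sup[OF _ _ continuous_on_det] Y(1) by (metis empty_iff)
  have pos: "0 < det M" using M(2)[OF Y(1)] pos_def_det_pos[OF Y(2)] by simp
  have "perturbed \<alpha> \<subseteq> psd" by (auto simp: spectrahedron_def)
  from det_maximizer_unique[OF spectrahedron_convex[OF linear] this M(1) _ M(2) pos]
  have "path_point \<A> b \<alpha> = M"
    unfolding path_point_def using M pos by (intro THE_is_arg_max_eln) auto
  then show "path_point \<A> b \<alpha> \<in> perturbed \<alpha>" "path_point \<A> b \<alpha> \<in> pos_def"
    "\<And>X. X \<in> perturbed \<alpha> \<Longrightarrow> det X \<le> det (path_point \<A> b \<alpha>)"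
    using M pos psd_det_nonzero_imp_pos_def[of M] by (auto simp: spectrahedron_def)
qed

text \<open>The competitor \<open>X + \<alpha> (I + D)\<close> in \<open>perturbed \<alpha>\<close>, with \<open>D\<close> chosen such that its trailing
  block is \<open>\<alpha> S\<close>, equals \<open>T Z T\<close> for \<open>T = scaling J (sqrt \<alpha>)\<close> and some \<open>Z\<close> converging to
  \<open>X + S\<close>.  Both sides of the inequality arise by dividing out \<open>(det T)\<^sup>2\<close>.\<close>

lemma competitor:
  assumes X: "X \<in> F" and S: "S \<in> slices" and pd: "X + S \<in> pos_def"
  obtains Z where "(Z \<longlongrightarrow> X + S) (at_right 0)"
    "\<forall>\<^sub>F \<alpha> in at_right 0. det (Z \<alpha>)
      \<le> det (block J (path_point \<A> b \<alpha>) + (1 / \<alpha>) *\<^sub>R block (- J) (path_point \<A> b \<alpha>))"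
proof -
  obtain D where D: "D \<in> null_space \<A>" "S - E = block (- J) D" using S by (auto simp: slices_def)
  \<comment> \<open>Undoing \<open>T\<close> on both sides divides off-diagonal blocks by
    \<open>sqrt \<alpha>\<close> and the trailing block by \<open>\<alpha>\<close>. The off-diagonal
    part of \<open>D\<close> thus keeps a factor \<open>sqrt \<alpha>\<close>, and the trailing
    block becomes exactly \<open>S\<close>.\<close>
  define Z where "Z \<alpha> = X + S + sqrt \<alpha> *\<^sub>R (D - block J D - block (- J) D)
      + \<alpha> *\<^sub>R block J (D + mat 1)" for \<alpha>
  have SJ: "S \<in> psd_on (- J)" using S by (simp add: slices_def)
  have XJ: "X \<in> psd_on J" using X on_face by blast
  have sym: "X \<in> sym_mats" "S \<in> sym_mats" "D \<in> sym_mats"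
    using XJ SJ D(1) by (auto simp: psd_on_def psd_def null_space_def)
  have "((\<lambda>\<alpha>. X + S + sqrt \<alpha> *\<^sub>R (D - block J D - block (- J) D) + \<alpha> *\<^sub>R block J (D + mat 1))
      \<longlongrightarrow> X + S + sqrt 0 *\<^sub>R (D - block J D - block (- J) D) + 0 *\<^sub>R block J (D + mat 1)) (at_right 0)"
    by (intro tendsto_intros)
  then have lim: "(Z \<longlongrightarrow> X + S) (at_right 0)" by (simp add: Z_def[abs_def])
  have "Z \<alpha> \<in> sym_mats" for \<alpha>
    using sym by (auto simp: sym_mats_iff Z_def block_def mat_def)
  then have "\<forall>\<^sub>F \<alpha> in at_right 0. Z \<alpha> \<in> pos_def" by (rule eventually_pos_def[OF pd lim])
  moreover have "\<forall>\<^sub>F \<alpha> in at_right (0::real). 0 < \<alpha>" by (simp add: eventually_at_right_less)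
  ultimately have "\<forall>\<^sub>F \<alpha> in at_right 0. det (Z \<alpha>)
      \<le> det (block J (path_point \<A> b \<alpha>) + (1 / \<alpha>) *\<^sub>R block (- J) (path_point \<A> b \<alpha>))"
  proof eventually_elim
    case (elim \<alpha>)
    let ?T = "scaling J (sqrt \<alpha>)" and ?P = "path_point \<A> b \<alpha>"
    let ?Q = "block J ?P + (1 / \<alpha>) *\<^sub>R block (- J) ?P"
    have sq: "sqrt \<alpha> * x * sqrt \<alpha> = \<alpha> * x" for x
      using elim by (metis abs_of_pos mult.assoc mult.commute real_sqrt_mult_self)
    have dT: "det ?T \<noteq> 0" using elim by (simp add: det_scaling_nonzero)
    have Scomp: "S $ i $ j = mat 1 $ i $ j + D $ i $ j" if "i \<notin> J" "j \<notin> J" for i j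
      using arg_cong[OF D(2), of "\<lambda>M. M $ i $ j"] that by (simp add: block_def)
    have TZT: "?T ** Z \<alpha> ** ?T = X + \<alpha> *\<^sub>R (mat 1 + D)"
    proof -
      have "(?T ** Z \<alpha> ** ?T) $ i $ j = (X + \<alpha> *\<^sub>R (mat 1 + D)) $ i $ j" for i j
        unfolding scaling_congruence using elim psd_on_component[OF XJ, of i j] psd_on_component[OF SJ, of i j]
        by (cases "i \<in> J"; cases "j \<in> J")
          (auto simp: Z_def block_def Scomp mat_def algebra_simps)
      then show ?thesis by (simp add: vec_eq_iff)
    qed
    have "?T ** Z \<alpha> ** ?T \<in> pos_def"
      using pos_def_congruence[OF elim(1) dT] by (simp add: transpose_scaling)
    moreover have "\<A> (X + \<alpha> *\<^sub>R (mat 1 + D)) = b + \<alpha> *\<^sub>R \<A> (mat 1)"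
      using X D(1) linear by (simp add: spectrahedron_def null_space_def linear_add linear_scale)
    ultimately have "?T ** Z \<alpha> ** ?T \<in> perturbed \<alpha>"
      using pos_def_imp_psd[of "?T ** Z \<alpha> ** ?T"] by (simp add: spectrahedron_def TZT)
    then have "det (?T ** Z \<alpha> ** ?T) \<le> det ?P" by (rule path_point_maximizes(3)[OF elim(2)])
    also have "\<dots> \<le> det (block J ?P + block (- J) ?P)"
      by (rule fischer_inequality[OF path_point_maximizes(2)[OF elim(2)]])
    \<comment> \<open>Conjugation by \<open>?T\<close> restores the factor \<open>\<alpha>\<close>
      removed from the trailing block in \<open>?Q\<close>, so both sides now carry the same square
      of \<open>det ?T\<close>.\<close>
    also have "block J ?P + block (- J) ?P = ?T ** ?Q ** ?T"
    proof -
      have "(block J ?P + block (- J) ?P) $ i $ j = (?T ** ?Q ** ?T) $ i $ j" for i j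
        unfolding scaling_congruence using elim by (auto simp: block_def sq)
      then show ?thesis by (simp add: vec_eq_iff)
    qed
    finally have "(det ?T)\<^sup>2 * det (Z \<alpha>) \<le> (det ?T)\<^sup>2 * det ?Q"
      by (simp add: det_mul power2_eq_square mult_ac)
    then show ?case using dT by simp
  qed
  with lim show thesis by (rule that)
qed

text \<open>The competitors bound the rescaled determinants from below by values tending to the
  maximum over \<open>G\<close>, while every limit of the rescaled blocks lies in \<open>G\<close>;
  uniqueness of the maximizer then determines the limit.\<close>

lemma path_tendsto_unique_maximizer:
  obtains X where "X \<in> F" "(path_point \<A> b \<longlongrightarrow> X) (at_right 0)" "0 < det (X + E)"
    "\<And>Y. Y \<in> F \<Longrightarrow> det (Y + E) \<le> det (X + E)"
    "\<And>Y. Y \<in> F \<Longrightarrow> det (Y + E) = det (X + E) \<Longrightarrow> Y = X"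
proof -
  \<comment> \<open>Pairs are encoded as sums: complementary supports make the summands recoverable,
    and one uniqueness result covers both blocks.\<close>
  define G where "G = {X + S | X S. X \<in> F \<and> S \<in> slices}"
  obtain X1 where X1: "X1 \<in> F" "X1 + E \<in> pos_def" using face_interior by blast
  have Epsd: "E \<in> psd_on (- J)" using E_in_slices by (simp add: slices_def)
  have "X1 + E \<in> G" using X1 E_in_slices by (auto simp: G_def)
  moreover have "compact G" unfolding G_def by (rule compact_sums[OF compact_F slices_compact])
  ultimately obtain M where M: "M \<in> G" "\<And>Y. Y \<in> G \<Longrightarrow> det Y \<le> det M"
    using continuous_attains_sup[OF _ _ continuous_on_det] by (metis empty_iff)
  have Mpos: "0 < det M" using M(2)[OF \<open>X1 + E \<in> G\<close>] pos_def_det_pos[OF X1(2)] by simp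
  have Gpsd: "G \<subseteq> psd" by (auto simp: G_def spectrahedron_def slices_def psd_on_def intro: psd_add)
  have "G = (\<Union>x\<in>F. \<Union>y\<in>slices. {x + y})" by (auto simp: G_def)
  then have "convex G" using convex_sums[OF spectrahedron_convex[OF linear] slices_convex] by simp
  note M_unique = det_maximizer_unique[OF this Gpsd M(1) _ M(2) Mpos]
  obtain X S where XS: "X \<in> F" "S \<in> slices" "M = X + S" using M(1) by (auto simp: G_def)
  have SJ: "S \<in> psd_on (- J)" using XS(2) by (simp add: slices_def)
  have FJ: "Y \<in> psd_on J" if "Y \<in> F" for Y using that on_face by blast
  have blockJ_slice: "block J T = 0" if "T \<in> slices" for T
    using that block_psd_on_compl[of T "- J"] by (simp add: slices_def)
  have blockJ_sum: "block J (Y + T) = Y" if "Y \<in> F" "T \<in> slices" for Y T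
    using block_psd_on_eq[OF FJ[OF that(1)]] blockJ_slice[OF that(2)] by (simp add: linear_add[OF linear_block])
  note split = det_complementary_blocks[OF FJ SJ]
  have YE: "Y + E \<in> psd" if "Y \<in> F" for Y
    using that Epsd by (auto simp: psd_on_def spectrahedron_def intro: psd_add)
  have "det (X + E) \<noteq> 0" using Mpos XS split[OF XS(1)] by auto
  then have XE: "0 < det (X + E)"
    using YE[OF XS(1)] by (intro pos_def_det_pos psd_det_nonzero_imp_pos_def)
  then have c: "0 < det (block J (mat 1) + S)"
    using Mpos XS split[OF XS(1)] by (simp add: zero_less_mult_iff)
  \<comment> \<open>With the trailing part \<open>S\<close> fixed, its positive factor cancels, and
    maximality over \<open>G\<close> becomes maximality over \<open>F\<close>.\<close>
  have max: "det (Y + E) \<le> det (X + E)" if "Y \<in> F" for Y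
  proof -
    have "det (Y + S) \<le> det (X + S)" using M(2)[of "Y + S"] that XS by (auto simp: G_def)
    then show ?thesis using c by (simp add: split[OF that] split[OF XS(1)])
  qed
  have unique: "Y = X" if "Y \<in> F" "det (Y + E) = det (X + E)" for Y
  proof -
    have "Y + S \<in> G" using that XS by (auto simp: G_def)
    moreover have "det (Y + S) = det M" using that split XS by simp
    ultimately have "Y + S = M" by (intro M_unique)
    then show ?thesis using XS(3) by simp
  qed
  obtain Z where Z: "(Z \<longlongrightarrow> M) (at_right 0)" "\<forall>\<^sub>F \<alpha> in at_right 0. det (Z \<alpha>)
      \<le> det (block J (path_point \<A> b \<alpha>) + (1 / \<alpha>) *\<^sub>R block (- J) (path_point \<A> b \<alpha>))"
    using competitor[OF XS(1,2)] psd_det_nonzero_imp_pos_def[of M] Gpsd M(1) Mpos XS(3) by auto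
  have "(path_point \<A> b \<longlongrightarrow> X) (at_right 0)"
  proof (rule tendsto_at_right_subseq)
    fix a :: "nat \<Rightarrow> real" assume a: "\<And>k. 0 < a k" "a \<longlonglongrightarrow> 0"
    define P where "P k = path_point \<A> b (a k)" for k
    define T where "T k = (1 / a k) *\<^sub>R block (- J) (P k)" for k
    have P: "P k \<in> perturbed (a k)" for k unfolding P_def by (rule path_point_maximizes(1)[OF a(1)])
    obtain A where A: "\<And>k. \<bar>a k\<bar> \<le> A"
      using convergent_imp_bounded[OF a(2)] by (auto simp: bounded_iff)
    obtain C where C: "\<And>X \<alpha>. X \<in> perturbed \<alpha> \<Longrightarrow> norm X \<le> C * (1 + \<bar>\<alpha>\<bar>)" using perturbed_bound by metis
    have "norm (P k) \<le> \<bar>C\<bar> * (1 + A)" for k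
    proof -
      have "norm (P k) \<le> C * (1 + \<bar>a k\<bar>)" by (rule C[OF P])
      also have "\<dots> \<le> \<bar>C\<bar> * (1 + A)" by (intro mult_mono) (use A in auto)
      finally show ?thesis .
    qed
    \<comment> \<open>The path points are bounded and their rescaled trailing blocks lie in a
      compact set, so one subsequence makes both converge.\<close>
    then have "\<forall>k. (P k, T k) \<in> cball 0 (\<bar>C\<bar> * (1 + A)) \<times> slices"
      using perturbed_slice[OF P a(1)] by (simp add: T_def)
    moreover have "compact (cball (0 :: real^'n^'n) (\<bar>C\<bar> * (1 + A)) \<times> slices)"
      by (intro compact_Times compact_cball slices_compact)
    ultimately obtain L r where L: "L \<in> cball 0 (\<bar>C\<bar> * (1 + A)) \<times> slices" "strict_mono (r :: nat \<Rightarrow> nat)"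
      "((\<lambda>k. (P k, T k)) \<circ> r) \<longlonglongrightarrow> L"
      unfolding compact_def by meson
    have Plim: "(P \<circ> r) \<longlonglongrightarrow> fst L" and Tlim: "(T \<circ> r) \<longlonglongrightarrow> snd L"
      using tendsto_fst[OF L(3)] tendsto_snd[OF L(3)] by (simp_all add: o_def)
    have alim: "(a \<circ> r) \<longlonglongrightarrow> 0" by (rule LIMSEQ_subseq_LIMSEQ[OF a(2) L(2)])
    have L1: "fst L \<in> F"
    proof -
      have "fst L \<in> psd"
        by (rule closed_sequentially[OF closed_psd _ Plim]) (use P in \<open>auto simp: spectrahedron_def\<close>)
      moreover have "\<A> (fst L) = b"
      proof (rule LIMSEQ_unique)
        show "(\<lambda>k. \<A> ((P \<circ> r) k)) \<longlonglongrightarrow> \<A> (fst L)"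
          using linear by (intro bounded_linear.tendsto[OF _ Plim]) (simp add: linear_linear)
        have "(\<lambda>k. b + (a \<circ> r) k *\<^sub>R \<A> (mat 1)) \<longlonglongrightarrow> b + 0 *\<^sub>R \<A> (mat 1)"
          by (intro tendsto_intros alim)
        moreover have "\<A> ((P \<circ> r) k) = b + (a \<circ> r) k *\<^sub>R \<A> (mat 1)" for k
          using P[of "r k"] by (simp add: spectrahedron_def)
        ultimately show "(\<lambda>k. \<A> ((P \<circ> r) k)) \<longlonglongrightarrow> b" by simp
      qed
      ultimately show ?thesis by (simp add: spectrahedron_def)
    qed
    have L2: "snd L \<in> slices" using L(1) by auto
    then have LG: "fst L + snd L \<in> G" using L1 by (auto simp: G_def)
    have ar: "filterlim (a \<circ> r) (at_right 0) sequentially"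
      using alim a(1) by (simp add: filterlim_at less_imp_neq[THEN not_sym])
    \<comment> \<open>The limit of the competitor inequality; as \<open>fst L + snd L\<close> lies
      in \<open>G\<close>, equality must hold.\<close>
    have "det M \<le> det (fst L + snd L)"
    proof (rule tendsto_le)
      have det_lim: "isCont det Y" for Y :: "real^'n^'n"
        using continuous_on_det[of "UNIV :: (real^'n^'n) set"] by (simp add: continuous_on_eq_continuous_at)
      show "(\<lambda>k. det (Z ((a \<circ> r) k))) \<longlonglongrightarrow> det M"
        by (rule isCont_tendsto_compose[OF det_lim filterlim_compose[OF Z(1) ar]])
      have "(\<lambda>k. block J ((P \<circ> r) k)) \<longlonglongrightarrow> block J (fst L)"
        using linear_block by (intro bounded_linear.tendsto[OF _ Plim]) (simp add: linear_linear)
      then have "(\<lambda>k. block J ((P \<circ> r) k) + (T \<circ> r) k) \<longlonglongrightarrow> fst L + snd L"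
        using tendsto_add[OF _ Tlim] block_psd_on_eq[OF FJ[OF L1]] by force
      then show "(\<lambda>k. det (block J ((P \<circ> r) k) + (T \<circ> r) k)) \<longlonglongrightarrow> det (fst L + snd L)"
        by (rule isCont_tendsto_compose[OF det_lim])
      show "\<forall>\<^sub>F k in sequentially. det (Z ((a \<circ> r) k)) \<le> det (block J ((P \<circ> r) k) + (T \<circ> r) k)"
        using eventually_compose_filterlim[OF Z(2) ar] by (simp add: P_def T_def)
    qed simp
    with M(2)[OF LG] have "det (fst L + snd L) = det M" by (rule antisym)
    with LG have "fst L + snd L = M" by (intro M_unique)
    \<comment> \<open>Applying \<open>block J\<close> to both decompositions of \<open>M\<close>
      removes the slices.\<close>
    then have "fst L = X"
      using blockJ_sum[OF L1 L2] blockJ_sum[OF XS(1,2)] XS(3) by simp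
    then show "\<exists>r. strict_mono r \<and> (path_point \<A> b \<circ> a \<circ> r) \<longlonglongrightarrow> X"
      using L(2) Plim by (auto simp: P_def o_def)
  qed
  from that[OF XS(1) this XE max unique] show thesis .
qed

end

text \<open>Existence of the limit is part of the conclusion. The columns \<open>V\<close> form an
  arbitrary basis of the range of an arbitrary relative interior point \<open>R\<close>, not just
  the coordinate basis.\<close>

theorem theorem3p15:
  fixes \<A> :: "real^'n^'n \<Rightarrow> real^'m" and b :: "real^'m"
    and J :: "'n set" and r q :: nat
    and A :: "nat \<Rightarrow> real^'n^'n"
    and V :: "nat \<Rightarrow> real^'n" and R :: "real^'n^'n"
  assumes linear: "linear \<A>"
    and surjective: "\<A> ` sym_mats = UNIV"
    and nonempty: "spectrahedron \<A> b \<noteq> {}"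
    and bounded: "bounded (spectrahedron \<A> b)"
    and in_proper_face: "\<exists>f. proper_psd_face f \<and> spectrahedron \<A> b \<subseteq> f"
    and card_J: "card J = r"
    and min_face: "min_face (spectrahedron \<A> b) = psd_on J"
    and q: "q + CARD('m) = CARD('n) * (CARD('n) + 1) div 2"
    and basis_inj: "inj_on A {1..q}"
    and basis_indep: "independent (A ` {1..q})"
    and basis_span: "span (A ` {1..q}) = null_space \<A>"
    and N_blocks: "span ((\<lambda>i. block (- J) (A i)) ` {1..q}) \<inter> psd_on (- J) = {0}"
    and relint: "R \<in> rel_interior (spectrahedron \<A> b)"
    and V: "range_basis r V R"
  shows "(path_point \<A> b \<longlongrightarrow> analytic_center r V (spectrahedron \<A> b)) (at_right 0)"
proof -
  have Fpsd: "spectrahedron \<A> b \<subseteq> psd" by (auto simp: spectrahedron_def)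
  note R = rel_interior_min_face[OF Fpsd spectrahedron_convex[OF linear] relint min_face]
  have FJ: "spectrahedron \<A> b \<subseteq> psd_on J" using subset_min_face min_face by metis
  interpret facial_spectrahedron \<A> b J
  proof (rule facial_spectrahedron.intro)
    \<comment> \<open>By linearity of \<open>block\<close>, the trailing blocks of the null space
      are exactly the span of those of the basis.\<close>
    show "block (- J) ` null_space \<A> \<inter> psd_on (- J) \<subseteq> {0}"
      using N_blocks linear_span_image[OF linear_block, of "- J" "A ` {1..q}"]
      by (simp add: image_image flip: basis_span)
    show "\<exists>X\<in>spectrahedron \<A> b. X + block (- J) (mat 1) \<in> pos_def"
      using R(1) relint rel_interior_subset by blast
  qed (use linear bounded FJ in auto)
  obtain X where X: "X \<in> spectrahedron \<A> b" "(path_point \<A> b \<longlongrightarrow> X) (at_right 0)"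
    "0 < det (X + block (- J) (mat 1))"
    "\<And>Y. Y \<in> spectrahedron \<A> b \<Longrightarrow> det (Y + block (- J) (mat 1)) \<le> det (X + block (- J) (mat 1))"
    "\<And>Y. Y \<in> spectrahedron \<A> b \<Longrightarrow> det (Y + block (- J) (mat 1)) = det (X + block (- J) (mat 1)) \<Longrightarrow> Y = X"
    by (rule path_tendsto_unique_maximizer) blast
  have "span (V ` {..<card J}) = {x. \<forall>i. i \<notin> J \<longrightarrow> x $ i = 0}"
    using V R(2) card_J by (simp add: range_basis_def)
  then obtain c where c: "0 < c" "\<And>Y. Y \<in> psd_on J \<Longrightarrow>
      det_upto r (\<lambda>i j. V i \<bullet> (Y *v V j)) = c * det (Y + block (- J) (mat 1))"
    unfolding card_J[symmetric] by (rule det_upto_compression) blast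
  \<comment> \<open>The positive factor \<open>c\<close> does not change the maximizer, so the point
    found as the limit is the analytic center.\<close>
  have "analytic_center r V (spectrahedron \<A> b) = X"
    unfolding analytic_center_def
    by (rule THE_is_arg_max_eln) (use X c FJ in \<open>auto simp: subset_iff\<close>)
  with X(2) show ?thesis by simp
qed

end
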